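(* Let $F\in\mathfrak N_n^+(\mathbb D)$, put $F_\lambda:=F-\lambda I_n$ for $\lambda\in\mathbb C$, and let $M_F:=\{\lambda\in\mathbb C:\det(F_\lambda)\equiv 0 \text{ in }\mathbb D\}$. Assume that for each $\lambda\in\mathbb C\setminus M_F$ the functions $\Theta_{\lambda,l}\in\mathfrak I_n(\mathbb D)$ (inner) and $E_{\lambda,l}\in\mathfrak E_n(\mathbb D)$ (outer) are factors in the multiplicative decomposition $$F_\lambda=E_{\lambda,l}\cdot\Theta_{\lambda,l}.$$ Suppose that $K$ is a bounded Borel subset of $\mathbb C$ with positive logarithmic capacity. Then there exists a $\lambda\in K\cap(\mathbb C\setminus M_F)$ for which $\Theta_{\lambda,l}$ is a Blaschke-Potapov product.
   Context: $\mathbb D$ is the open unit disc, $\mathbb T$ the unit circle, $m$ normalized Lebesgue measure on $\mathbb T$, $\mathfrak M_n$ the complex $n\times n$ matrices with the operator norm induced by the Euclidean norm. Smirnov class: $\mathfrak N_n^+(\mathbb D)$ is the set of holomorphic $F:\mathbb D\to\mathfrak M_n$ such that for each $\epsilon>0$ there is $\delta>0$ with $\int_\Delta \ln^+\|F(rt)\|\,m(dt)<\epsilon$ for all $r\in[0,1)$ and all Borel $\Delta\subseteq\mathbb T$ with $m(\Delta)<\delta$. Such $F$ has radial boundary values $\underline F(t)=\lim_{r\to1-0}F(rt)$ for $m$-a.e. $t$. Outer: a scalar function $e:\mathbb D\to\mathbb C$ is outer if $e(z)=C\exp\{\int_{\mathbb T}\frac{t+z}{t-z}\ln[w(t)]\,m(dt)\}$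 with $|C|=1$ and $w:\mathbb T\to[0,\infty)$ such that $\ln w$ is $m$-integrable. $\mathfrak E_n(\mathbb D)$ is the set of $E\in\mathfrak N_n^+(\mathbb D)$ with $\det E$ outer. Inner: $\mathfrak I_n(\mathbb D)$ is the set of holomorphic $\Theta:\mathbb D\to\mathfrak M_n$ with $\|\Theta(z)\|\le1$ on $\mathbb D$ and $\underline\Theta(t)$ unitary for $m$-a.e. $t$. Blaschke-Potapov products: for $a\in\mathbb D$ let $b_a(z)=\frac{|a|}{a}\frac{a-z}{1-\overline a z}$ if $a\ne0$ and $b_0(z)=z$; for a non-zero orthogonal projection matrix $P$ let $B_{a,P}(z)=I_n+[b_a(z)-1]P$. A left (resp. right) Blaschke-Potapov product is a constant function with unitary value, or a function of the form $\big(B_{z_1,P_1}B_{z_2,P_2}\cdots\big)V$ (resp. $V\big(\cdots B_{z_2,P_2}B_{z_1,P_1}\big)$), a finite or infinite product with $V$ unitary, $z_k\in\mathbb D$, $P_k$ non-zero orthogonal projection matrices and $\sum_k(1-|z_k|)\,\mathrm{tr}\,P_k<\infty$ (under this condition the products converge on $\mathbb D$). The left and right Blaschke-Potapov products form the same class, so one speaks simply of a Blaschke-Potapov product. Capacity: for a finite nonnegative Borel measure $\nu$ on $\mathbb C$ with compact support, its logarithmic potential is $U^{(\nu)}(\xi)=\int_{\mathbb C}\ln|\xi-\lambda|\,\nu(d\lambda)$. A bounded Borel set $K\subset\mathbb C$ is said to have positive logarithmic capacity if there is a nonzero finite nonnegative Borel measure $\nu$ with $\nu(\mathbb C\setminus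 K)=0$ for which $U^{(\nu)}$ is a (finite real-valued) continuous function on $\mathbb C$. *)

theory Defs
  imports "HOL-Complex_Analysis.Complex_Analysis"
begin

unbundle no fps_syntax

(* Matrix functions on the unit disc have type complex => complex^'n^'n; their values
   outside ball 0 1 are irrelevant and never constrained. *)

definition circle_measure :: "complex measure" where
  "circle_measure =
     distr (uniform_measure lborel {0..<2 * pi}) (restrict_space borel (sphere 0 1)) cis"

definition opnorm :: "complex^'n^'n \<Rightarrow> real" where
  "opnorm A = onorm (\<lambda>x. A *v x)"

definition conj_transpose :: "complex^'n^'n \<Rightarrow> complex^'n^'n" where
  "conj_transpose A = (\<chi> i j. cnj (A $ j $ i))"

definition unitary_matrix :: "complex^'n^'n \<Rightarrow> bool" where
  "unitary_matrix U \<longleftrightarrow>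
     conj_transpose U ** U = mat 1 \<and> U ** conj_transpose U = mat 1"

definition orthogonal_projection :: "complex^'n^'n \<Rightarrow> bool" where
  "orthogonal_projection P \<longleftrightarrow> P ** P = P \<and> conj_transpose P = P"

definition matrix_holomorphic :: "(complex \<Rightarrow> complex^'n^'n) \<Rightarrow> bool" where
  "matrix_holomorphic F \<longleftrightarrow> (\<forall>i j. (\<lambda>z. F z $ i $ j) holomorphic_on ball 0 1)"

definition has_radial_limit ::
    "(complex \<Rightarrow> complex^'n^'n) \<Rightarrow> complex \<Rightarrow> complex^'n^'n \<Rightarrow> bool" where
  "has_radial_limit F t L \<longleftrightarrow> ((\<lambda>r::real. F (of_real r * t)) \<longlongrightarrow> L) (at_left 1)"

(* ln 0 = 0 for the library logarithm, so that ln_plus 0 = 0 as it should be. *)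
definition ln_plus :: "real \<Rightarrow> real" where
  "ln_plus x = max 0 (ln x)"

definition smirnov_class :: "(complex \<Rightarrow> complex^'n^'n) set" where
  "smirnov_class = {F. matrix_holomorphic F \<and>
     (\<forall>\<epsilon>>0. \<exists>\<delta>>0. \<forall>r\<in>{0..<1::real}. \<forall>\<Delta>\<in>sets circle_measure.
        measure circle_measure \<Delta> < \<delta> \<longrightarrow>
        (LINT t:\<Delta>|circle_measure. ln_plus (opnorm (F (of_real r * t)))) < \<epsilon>)}"

(* Integrability of ln w with the convention ln 0 = -infinity forces w > 0 almost everywhere;
   since ln 0 = 0 in the library, this has to be said separately. *)
definition outer_function :: "(complex \<Rightarrow> complex) \<Rightarrow> bool" where
  "outer_function e \<longleftrightarrow>
     (\<exists>C (w :: complex \<Rightarrow> real).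
        norm C = 1 \<and> (\<forall>t\<in>sphere 0 1. 0 \<le> w t) \<and>
        (AE t in circle_measure. 0 < w t) \<and>
        integrable circle_measure (\<lambda>t. ln (w t)) \<and>
        (\<forall>z\<in>ball 0 1.
           e z = C * exp (LINT t|circle_measure. (t + z) / (t - z) * of_real (ln (w t)))))"

definition outer_class :: "(complex \<Rightarrow> complex^'n^'n) set" where
  "outer_class = {E \<in> smirnov_class. outer_function (\<lambda>z. det (E z))}"

definition inner_class :: "(complex \<Rightarrow> complex^'n^'n) set" where
  "inner_class = {\<Theta>. matrix_holomorphic \<Theta> \<and> (\<forall>z\<in>ball 0 1. opnorm (\<Theta> z) \<le> 1) \<and>
     (AE t in circle_measure. \<exists>U. has_radial_limit \<Theta> t U \<and> unitary_matrix U)}"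

definition blaschke_factor :: "complex \<Rightarrow> complex \<Rightarrow> complex" where
  "blaschke_factor a z =
     (if a = 0 then z else of_real (norm a) / a * ((a - z) / (1 - cnj a * z)))"

(* mat c ** P is the scalar multiple c P; the operation * on matrices is entrywise. *)
definition bp_factor :: "complex \<Rightarrow> complex^'n^'n \<Rightarrow> complex \<Rightarrow> complex^'n^'n" where
  "bp_factor a P z = mat 1 + mat (blaschke_factor a z - 1) ** P"

primrec left_partial_product :: "(nat \<Rightarrow> complex^'n^'n) \<Rightarrow> nat \<Rightarrow> complex^'n^'n" where
  "left_partial_product B 0 = mat 1"
| "left_partial_product B (Suc N) = left_partial_product B N ** B N"

primrec right_partial_product :: "(nat \<Rightarrow> complex^'n^'n) \<Rightarrow> nat \<Rightarrow> complex^'n^'n" where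
  "right_partial_product B 0 = mat 1"
| "right_partial_product B (Suc N) = B N ** right_partial_product B N"

(* In the next two definitions the factors are indexed from 0, and the finite products
   with N = 0 are the constant functions with unitary value. *)
definition left_blaschke_potapov :: "(complex \<Rightarrow> complex^'n^'n) \<Rightarrow> bool" where
  "left_blaschke_potapov \<Theta> \<longleftrightarrow>
     (\<exists>V (a :: nat \<Rightarrow> complex) (P :: nat \<Rightarrow> complex^'n^'n).
        unitary_matrix V \<and>
        (\<forall>k. a k \<in> ball 0 1 \<and> orthogonal_projection (P k) \<and> P k \<noteq> 0) \<and>
        ((\<exists>N. \<forall>z\<in>ball 0 1. \<Theta> z = left_partial_product (\<lambda>k. bp_factor (a k) (P k) z) N ** V) \<or>
         (summable (\<lambda>k. (1 - norm (a k)) * Re (trace (P k))) \<and>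
          (\<forall>z\<in>ball 0 1.
             (\<lambda>N. left_partial_product (\<lambda>k. bp_factor (a k) (P k) z) N ** V)
               \<longlonglongrightarrow> \<Theta> z))))"

definition right_blaschke_potapov :: "(complex \<Rightarrow> complex^'n^'n) \<Rightarrow> bool" where
  "right_blaschke_potapov \<Theta> \<longleftrightarrow>
     (\<exists>V (a :: nat \<Rightarrow> complex) (P :: nat \<Rightarrow> complex^'n^'n).
        unitary_matrix V \<and>
        (\<forall>k. a k \<in> ball 0 1 \<and> orthogonal_projection (P k) \<and> P k \<noteq> 0) \<and>
        ((\<exists>N. \<forall>z\<in>ball 0 1. \<Theta> z = V ** right_partial_product (\<lambda>k. bp_factor (a k) (P k) z) N) \<or>
         (summable (\<lambda>k. (1 - norm (a k)) * Re (trace (P k))) \<and>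
          (\<forall>z\<in>ball 0 1.
             (\<lambda>N. V ** right_partial_product (\<lambda>k. bp_factor (a k) (P k) z) N)
               \<longlonglongrightarrow> \<Theta> z))))"

definition blaschke_potapov_product :: "(complex \<Rightarrow> complex^'n^'n) \<Rightarrow> bool" where
  "blaschke_potapov_product \<Theta> \<longleftrightarrow> left_blaschke_potapov \<Theta> \<or> right_blaschke_potapov \<Theta>"

definition log_potential :: "complex measure \<Rightarrow> complex \<Rightarrow> real" where
  "log_potential \<nu> \<xi> = (LINT x|\<nu>. ln (norm (\<xi> - x)))"

(* The potential is finite at \<xi> iff \<nu> has no atom at \<xi> and the logarithmic kernel is
   integrable; the first condition is not implied by the second because ln 0 = 0 in the
   library. *)
definition finite_log_potential :: "complex measure \<Rightarrow> complex \<Rightarrow> bool" where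
  "finite_log_potential \<nu> \<xi> \<longleftrightarrow>
     emeasure \<nu> {\<xi>} = 0 \<and> integrable \<nu> (\<lambda>x. ln (norm (\<xi> - x)))"

(* Meaningful for bounded Borel sets K. *)
definition positive_log_capacity :: "complex set \<Rightarrow> bool" where
  "positive_log_capacity K \<longleftrightarrow>
     (\<exists>\<nu>. finite_measure \<nu> \<and> sets \<nu> = sets borel \<and> emeasure \<nu> UNIV \<noteq> 0 \<and>
        (\<exists>S. compact S \<and> emeasure \<nu> (UNIV - S) = 0) \<and>
        emeasure \<nu> (UNIV - K) = 0 \<and>
        (\<forall>\<xi>. finite_log_potential \<nu> \<xi>) \<and> continuous_on UNIV (log_potential \<nu>))"

definition matrix_shift :: "(complex \<Rightarrow> complex^'n^'n) \<Rightarrow> complex \<Rightarrow> complex \<Rightarrow> complex^'n^'n" where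
  "matrix_shift F \<mu> z = F z - mat \<mu>"

definition degenerate_set :: "(complex \<Rightarrow> complex^'n^'n) \<Rightarrow> complex set" where
  "degenerate_set F = {\<mu>. \<forall>z\<in>ball 0 1. det (matrix_shift F \<mu> z) = 0}"

end

theory Submission
  imports Defs "HOL-Computational_Algebra.Fundamental_Theorem_Algebra"
begin

no_notation fps_nth (infixl "$" 75)

text \<open>Put \<open>d\<^sub>\<mu> = det (F - \<mu>) = e\<^sub>\<mu> \<theta>\<^sub>\<mu>\<close> with \<open>e\<^sub>\<mu> = det E\<^sub>\<mu>\<close> outer and \<open>\<theta>\<^sub>\<mu> = det \<Theta>\<^sub>\<mu>\<close>.
  Continuity of the potential of \<open>\<nu>\<close> makes \<open>\<integral> (- N - ln |\<xi> - \<mu>|)\<^sup>+ \<nu>(d\<mu>)\<close> uniformly small in \<open>\<xi>\<close> for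
  large \<open>N\<close> (Dini), and factoring \<open>d\<^sub>\<mu>\<close> over the eigenvalues of \<open>F(z)\<close> the same holds for
  \<open>\<integral> (- N - ln |d\<^sub>\<mu>(z)|)\<^sup>+ \<nu>(d\<mu>)\<close>, uniformly in \<open>z\<close>. By Fubini and Fatou, for \<open>\<nu>\<close>-almost all \<open>\<mu>\<close>
  the circle means of \<open>(- N - ln |d\<^sub>\<mu>|)\<^sup>+\<close> become small along radii tending to 1. As
  \<open>|\<theta>\<^sub>\<mu>| \<rightarrow> 1\<close> radially almost everywhere and \<open>ln |e\<^sub>\<mu>|\<close> is a uniformly integrable Poisson integral,
  the circle means of \<open>- ln |\<theta>\<^sub>\<mu>|\<close> then come arbitrarily close to 0, i.e. \<open>\<theta>\<^sub>\<mu>\<close> has no singular part.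
  No boundary values of \<open>F\<close> are needed. Finally, Potapov's procedure of splitting off
  elementary factors at the zeros of \<open>\<theta>\<^sub>\<mu>\<close> leaves contractive factors whose determinants at 0 tend to
  modulus 1, hence which tend to a unitary constant.\<close>

section \<open>Contractions on complex Euclidean space\<close>

text \<open>Only one measure \<open>\<nu>\<close> has to ignore the bad values of
  \<open>\<mu>\<close>, so everything is averaged over \<open>\<nu>\<close> before a single
  \<open>\<mu>\<close> is picked. Fatou's lemma then controls a lower limit along one fixed sequence
  of radii; that suffices, because one radius with a small mean of -ln |\<theta>| is enough for each
  \<epsilon>. The truncation level \<open>N\<close> is what makes the exceptional arcs harmless: on
  a set E of the circle, -ln |d| is at most \<open>N\<close> plus the excess, which costs N m(E)
  plus a small error, and \<open>N\<close> is fixed before E is made small. The singular part of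
  \<theta> is never constructed. A remainder left after splitting off factors has a determinant g
  with |\<theta>| \<le> |g| \<le> 1. If g is zero-free on a disc of radius larger than r, the mean
  value property of ln |g| bounds -ln |g(0)| by the mean of -ln |\<theta>| over the circle of radius
  r, and this is the only way in which \<theta> enters the factorization. The matrix facts rest on
  two devices: powers of one matrix combined with bounds that depend on the dimension only, and
  scalar functions \<open>cinner (M z *v x) y\<close>, to which the maximum principle
  applies.\<close>

definition cinner :: "complex^'n \<Rightarrow> complex^'n \<Rightarrow> complex" where
  "cinner u v = (\<Sum>i\<in>UNIV. u $ i * cnj (v $ i))"

lemma cinner_add_left: "cinner (u + v) w = cinner u w + cinner v w"
  by (simp add: cinner_def algebra_simps sum.distrib)

lemma cinner_diff_left: "cinner (u - v) w = cinner u w - cinner v w"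
  by (simp add: cinner_def algebra_simps sum_subtractf)

lemma cinner_scale_left: "cinner (c *s u) v = c * cinner u v"
  by (simp add: cinner_def sum_distrib_left mult.assoc)

lemma cinner_scale_right: "cinner u (c *s v) = cnj c * cinner u v"
  by (simp add: cinner_def sum_distrib_left mult_ac)

lemma Re_cinner: "Re (cinner u v) = u \<bullet> v"
  by (simp add: cinner_def inner_vec_def inner_complex_def)

lemma cinner_self: "cinner u u = of_real ((norm u)\<^sup>2)"
proof (rule complex_eqI)
  show "Re (cinner u u) = Re (of_real ((norm u)\<^sup>2))"
    by (simp add: Re_cinner power2_norm_eq_inner)
  show "Im (cinner u u) = Im (of_real ((norm u)\<^sup>2))"
    by (simp add: cinner_def)
qed

lemma norm_vector_scale: "norm (c *s u) = norm c * norm (u :: complex^'n)"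
proof -
  have "complex_of_real ((norm (c *s u))\<^sup>2) = (c * cnj c) * cinner u u"
    unfolding cinner_self[symmetric] by (simp only: cinner_scale_left cinner_scale_right mult_ac)
  also have "\<dots> = of_real ((norm c * norm u)\<^sup>2)"
    unfolding cinner_self complex_norm_square[symmetric] by (simp add: power_mult_distrib)
  finally have "complex_of_real ((norm (c *s u))\<^sup>2) = of_real ((norm c * norm u)\<^sup>2)" .
  then show ?thesis
    by (metis mult_nonneg_nonneg norm_ge_zero of_real_eq_iff power2_eq_imp_eq)
qed

text \<open>Multiplying \<open>u\<close> by a unimodular scalar makes the Hermitian product real and
  nonnegative, which reduces the claim to the real Cauchy-Schwarz inequality.\<close>

lemma norm_cinner_le: "norm (cinner u v) \<le> norm u * norm v"
proof (cases "cinner u v = 0")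
  case False
  let ?c = "cinner u v"
  have "cnj (sgn ?c) * ?c = of_real (norm ?c)"
    using False complex_norm_square[of ?c] by (simp add: sgn_eq field_simps power2_eq_square)
  then have "norm ?c = Re (cinner (cnj (sgn ?c) *s u) v)"
    by (simp add: cinner_scale_left)
  also have "\<dots> \<le> norm (cnj (sgn ?c) *s u) * norm v"
    unfolding Re_cinner by (rule norm_cauchy_schwarz)
  also have "\<dots> = norm u * norm v"
    using False by (simp add: norm_vector_scale norm_sgn)
  finally show ?thesis .
qed simp

lemma cinner_adjoint: "cinner (A *v u) v = cinner u (conj_transpose A *v v)"
proof -
  have "cinner (A *v u) v = (\<Sum>i\<in>UNIV. \<Sum>j\<in>UNIV. A $ i $ j * u $ j * cnj (v $ i))"
    by (simp add: cinner_def matrix_vector_mult_def sum_distrib_right)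
  also have "\<dots> = (\<Sum>j\<in>UNIV. \<Sum>i\<in>UNIV. A $ i $ j * u $ j * cnj (v $ i))"
    by (rule sum.swap)
  also have "\<dots> = cinner u (conj_transpose A *v v)"
    by (simp add: cinner_def matrix_vector_mult_def conj_transpose_def cnj_sum sum_distrib_left mult_ac)
  finally show ?thesis .
qed

lemma conj_transpose_conj_transpose [simp]: "conj_transpose (conj_transpose A) = A"
  by (simp add: conj_transpose_def vec_eq_iff)

lemma conj_transpose_mult: "conj_transpose (A ** B) = conj_transpose B ** conj_transpose A"
  by (simp add: conj_transpose_def vec_eq_iff matrix_matrix_mult_def cnj_sum mult.commute)

lemma det_conj_transpose: "det (conj_transpose A) = cnj (det A)"
proof -
  have "conj_transpose A = transpose (\<chi> i j. cnj (A $ i $ j))"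
    by (simp add: conj_transpose_def transpose_def)
  then have "det (conj_transpose A) = det (\<chi> i j. cnj (A $ i $ j))"
    by simp
  also have "\<dots> = cnj (det A)"
    by (simp add: det_def cnj_sum)
  finally show ?thesis .
qed

section \<open>Contractive matrices and the case of unimodular determinant\<close>

definition contraction :: "complex^'n^'n \<Rightarrow> bool" where
  "contraction A \<longleftrightarrow> (\<forall>x. norm (A *v x) \<le> norm x)"

lemma contractionD: "contraction A \<Longrightarrow> norm (A *v x) \<le> norm x"
  by (simp add: contraction_def)

lemma contraction_iff_opnorm: "contraction A \<longleftrightarrow> opnorm A \<le> 1"
proof
  assume "contraction A"
  then show "opnorm A \<le> 1"
    unfolding opnorm_def contraction_def by (intro onorm_le) auto
next
  assume *: "opnorm A \<le> 1"
  show "contraction A"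
    unfolding contraction_def
  proof
    fix x
    have "norm (A *v x) \<le> opnorm A * norm x"
      unfolding opnorm_def by (rule onorm) (rule matrix_vector_mul_bounded_linear)
    also have "\<dots> \<le> norm x"
      using * by (simp add: mult_left_le_one_le onorm_pos_le opnorm_def)
    finally show "norm (A *v x) \<le> norm x" .
  qed
qed

lemma contraction_mult: "contraction A \<Longrightarrow> contraction B \<Longrightarrow> contraction (A ** B)"
  unfolding contraction_def by (metis matrix_vector_mul_assoc order_trans)

lemma contraction_mat_1: "contraction (mat 1)"
  by (simp add: contraction_def)

text \<open>The choice \<open>y = A *v x\<close> suffices. The weak form matters because for a
  holomorphic matrix function each of these products is a scalar holomorphic function, open to the
  maximum principle.\<close>

lemma contractionI_cinner:
  assumes "\<And>x y. norm (cinner (A *v x) y) \<le> norm x * norm y"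
  shows "contraction A"
  unfolding contraction_def
proof
  fix x
  have "norm (A *v x) * norm (A *v x) \<le> norm x * norm (A *v x)"
    using assms[of x "A *v x"] by (simp add: cinner_self power2_eq_square norm_mult)
  then show "norm (A *v x) \<le> norm x"
    by (cases "norm (A *v x) = 0") (auto simp: mult_le_cancel_right)
qed

lemma contraction_conj_transpose:
  assumes "contraction A"
  shows "contraction (conj_transpose A)"
proof (rule contractionI_cinner)
  fix x y
  have "norm (cinner (conj_transpose A *v x) y) = norm (cinner x (A *v y))"
    by (simp add: cinner_adjoint)
  also have "\<dots> \<le> norm x * norm y"
    by (meson assms contractionD mult_left_mono norm_cinner_le norm_ge_zero order_trans)
  finally show "norm (cinner (conj_transpose A *v x) y) \<le> norm x * norm y" .
qed

lemma contraction_entry_le: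
  fixes A :: "complex^'n^'n"
  assumes "contraction A"
  shows "norm (A $ i $ j) \<le> 1"
proof -
  have "norm (A $ i $ j) = norm ((A *v axis j 1) $ i)"
    by (simp add: matrix_vector_mult_def axis_def if_distrib[of "\<lambda>u. _ * u"] cong: if_cong)
  also have "\<dots> \<le> norm (A *v axis j 1)"
    by (rule Finite_Cartesian_Product.norm_nth_le)
  also have "\<dots> \<le> norm (axis j 1 :: complex^'n)"
    by (rule contractionD[OF assms])
  finally show ?thesis by (simp add: norm_axis_1)
qed

text \<open>A crude count of the Leibniz terms. Only the independence of \<open>A\<close> matters,
  since the bound is applied to arbitrarily high powers and to the matrices in Cramer's
  rule.\<close>

lemma norm_det_le_fact:
  fixes A :: "complex^'n^'n"
  assumes "\<And>i j. norm (A $ i $ j) \<le> 1"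
  shows "norm (det A) \<le> fact CARD('n)"
proof -
  have "norm (det A) \<le> (\<Sum>p\<in>{p. p permutes (UNIV :: 'n set)}. 1)"
    unfolding det_def
  proof (rule sum_norm_le)
    fix p
    have "norm (\<Prod>i\<in>UNIV. A $ i $ p i) \<le> 1"
      unfolding prod_norm[symmetric] by (rule prod_le_1) (simp add: assms)
    then show "norm (of_int (sign p) * (\<Prod>i\<in>UNIV. A $ i $ p i)) \<le> 1"
      by (simp add: norm_mult sign_def)
  qed
  also have "\<dots> = fact CARD('n)"
    using card_permutations[of "UNIV :: 'n set" "CARD('n)"] by simp
  finally show ?thesis .
qed

text \<open>By homogeneity one may assume that \<open>A *v x\<close> has norm at most 1. Then the
  matrices in Cramer's rule have entries of modulus at most 1, so the inverse is bounded by a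
  constant of the dimension alone.\<close>

lemma norm_le_of_contraction_det:
  fixes A :: "complex^'n^'n"
  assumes A: "contraction A" and d: "norm (det A) = 1"
  shows "norm x \<le> CARD('n) * fact CARD('n) * norm (A *v x)"
proof -
  have *: "norm z \<le> CARD('n) * fact CARD('n)" if z: "norm (A *v z) \<le> 1" for z
  proof -
    have "norm z \<le> (\<Sum>k\<in>UNIV. norm (z $ k))"
      unfolding norm_vec_def by (rule L2_set_le_sum) simp
    also have "\<dots> \<le> (\<Sum>k\<in>(UNIV :: 'n set). fact CARD('n))"
    proof (rule sum_mono)
      fix k
      have "det A \<noteq> 0" using d by auto
      then have "z = (\<chi> k. det (\<chi> i j. if j = k then (A *v z) $ i else A $ i $ j) / det A)"
        by (subst cramer[symmetric]) simp_all
      then have "z $ k = det (\<chi> i j. if j = k then (A *v z) $ i else A $ i $ j) / det A"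
        by (metis (no_types, lifting) vec_lambda_beta)
      then have "norm (z $ k) = norm (det (\<chi> i j. if j = k then (A *v z) $ i else A $ i $ j))"
        by (simp add: norm_divide d)
      also have "\<dots> \<le> fact CARD('n)"
        using contraction_entry_le[OF A] order_trans[OF Finite_Cartesian_Product.norm_nth_le z]
        by (intro norm_det_le_fact) auto
      finally show "norm (z $ k) \<le> fact CARD('n)" .
    qed
    finally show ?thesis by simp
  qed
  show ?thesis
  proof (cases "A *v x = 0")
    case True
    have "det A \<noteq> 0" using d by auto
    then have "x = 0"
      using True invertible_det_nz invertible_left_inverse matrix_left_invertible_ker by blast
    then show ?thesis by simp
  next
    case False
    let ?c = "inverse (complex_of_real (norm (A *v x)))"
    have "norm (?c *s x) \<le> CARD('n) * fact CARD('n)"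
      using False by (intro *) (simp add: matrix_vector_mult_scaleR vec.scale norm_vector_scale norm_inverse)
    then show ?thesis
      using False by (simp add: norm_vector_scale norm_inverse norm_divide field_simps)
  qed
qed

text \<open>The norms of \<open>A\<^sup>j y\<close> form a log-convex sequence, while Cramer's rule bounds
  \<open>A\<^sup>-\<^sup>m\<close> uniformly in \<open>m\<close>; strict decay at one step would make \<open>A\<^sup>-\<^sup>m\<close> grow geometrically.\<close>
lemma hermitian_contraction_isometry:
  fixes A :: "complex^'n^'n"
  assumes A: "contraction A" and h: "conj_transpose A = A" and d: "norm (det A) = 1"
  shows "norm (A *v x) = norm x"
proof (rule ccontr)
  assume "norm (A *v x) \<noteq> norm x"
  with contractionD[OF A, of x] have lt: "norm (A *v x) < norm x" by simp
  define q where "q = norm (A *v x) / norm x"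
  have x0: "norm x > 0" using lt norm_ge_zero order_le_less_trans by blast
  have q: "0 \<le> q" "q < 1" using lt x0 by (auto simp: q_def)
  define M where "M k = (((**) A) ^^ k) (mat 1)" for k
  have M_Suc: "M (Suc k) = A ** M k" and M_0: "M 0 = mat 1" for k by (simp_all add: M_def)
  have M_contr: "contraction (M k)" and M_det: "norm (det (M k)) = 1" for k
    by (induction k) (simp_all add: M_0 M_Suc contraction_mat_1 contraction_mult A det_mul norm_mult d)
  define C where "C = (CARD('n) * fact CARD('n) :: real)"
  have "1 \<le> C * q ^ m" for m
  proof -
    have "invertible (M m)"
      using M_det[of m] by (auto simp: invertible_det_nz)
    then obtain B where "M m ** B = mat 1"
      using invertible_right_inverse by blast
    then have "M m *v (B *v x) = x" by (simp add: matrix_vector_mul_assoc)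
    \<comment> \<open>The orbit of \<open>y\<close> reaches \<open>x\<close> after exactly
      \<open>m\<close> steps, so that the strict decay observed at \<open>x\<close> sits at the end
      of the orbit and can be traced back to its start.\<close>
    then obtain y where y: "M m *v y = x" by blast
    define a where "a j = norm (M j *v y)" for j
    have am: "a m = norm x" and am1: "a (Suc m) = q * a m"
      using x0 by (simp_all add: a_def y M_Suc q_def matrix_vector_mul_assoc[symmetric])
    have a_ge: "norm y \<le> C * a j" for j
      unfolding a_def C_def by (rule norm_le_of_contraction_det[OF M_contr M_det])
    have "norm y > 0" using x0 y by auto
    moreover have "C > 0" by (simp add: C_def)
    ultimately have apos: "a j > 0" for j
      using a_ge[of j] by (metis less_le_trans zero_less_mult_pos)
    \<comment> \<open>Cauchy-Schwarz after one factor of the hermitian \<open>A\<close> has been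
      moved to the other side.\<close>
    have conv: "a (Suc j) * a (Suc j) \<le> a j * a (Suc (Suc j))" for j
    proof -
      have "complex_of_real ((a (Suc j))\<^sup>2) = cinner (A *v (M j *v y)) (M (Suc j) *v y)"
        unfolding a_def cinner_self[symmetric] M_Suc[of j] by (simp add: matrix_vector_mul_assoc)
      also have "\<dots> = cinner (M j *v y) (A *v (M (Suc j) *v y))"
        by (simp only: cinner_adjoint h)
      also have "\<dots> = cinner (M j *v y) (M (Suc (Suc j)) *v y)"
        by (simp only: M_Suc[of "Suc j"] matrix_vector_mul_assoc)
      finally have "norm (complex_of_real ((a (Suc j))\<^sup>2)) = norm (cinner (M j *v y) (M (Suc (Suc j)) *v y))"
        by (rule arg_cong)
      then show ?thesis
        using norm_cinner_le[of "M j *v y" "M (Suc (Suc j)) *v y"]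
        by (simp add: a_def norm_mult power2_eq_square)
    qed
    \<comment> \<open>By log-convexity the ratios of consecutive terms do not decrease, so the ratio
      \<open>q\<close> at index \<open>m\<close> bounds all earlier ones; the induction runs
      downwards from \<open>m\<close>.\<close>
    have step: "a (Suc (m - i)) \<le> q * a (m - i)" if "i \<le> m" for i
      using that
    proof (induction i)
      case 0
      then show ?case using am1 by simp
    next
      case (Suc i)
      define j where "j = m - Suc i"
      have j: "m - i = Suc j" using Suc.prems by (simp add: j_def)
      have "a (Suc (Suc j)) \<le> q * a (Suc j)" using Suc j by simp
      then have "a j * a (Suc (Suc j)) \<le> a j * (q * a (Suc j))"
        using apos[of j] by simp
      with conv[of j] have "a (Suc j) * a (Suc j) \<le> (q * a j) * a (Suc j)" by (simp add: mult_ac)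
      then have "a (Suc j) \<le> q * a j" using apos[of "Suc j"] by simp
      then show ?case by (simp add: j_def)
    qed
    have step': "a (Suc i) \<le> q * a i" if "i < m" for i
      using step[of "m - i"] that by simp
    have "a i \<le> q ^ i * a 0" if "i \<le> m" for i
      using that
    proof (induction i)
      case (Suc i)
      have "a (Suc i) \<le> q * a i" using step' Suc.prems by simp
      also have "\<dots> \<le> q * (q ^ i * a 0)" using Suc q by (intro mult_left_mono) auto
      finally show ?case by (simp add: mult_ac)
    qed simp
    then have "a m \<le> q ^ m * a 0" by simp
    also have "a 0 = norm y" by (simp add: a_def M_0)
    also have "q ^ m * norm y \<le> q ^ m * (C * a m)"
      using a_ge q by (intro mult_left_mono) auto
    finally have "1 * a m \<le> (C * q ^ m) * a m" by (simp add: mult_ac)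
    then show ?thesis using apos[of m] by (simp only: mult_le_cancel_right_pos)
  qed
  moreover have "(\<lambda>m. C * q ^ m) \<longlonglongrightarrow> 0"
    using LIMSEQ_realpow_zero[OF q] tendsto_mult_right_zero by blast
  ultimately have "1 \<le> (0::real)"
    by (meson LIMSEQ_le_const)
  then show False by simp
qed

text \<open>The hermitian case applies to \<open>conj_transpose V ** V\<close>, whose determinant is
  the squared modulus of \<open>det V\<close>. That product is the identity and not just an
  isometry, because its inner product with \<open>x\<close> attains equality in
  Cauchy-Schwarz.\<close>

lemma contraction_det_unimodular_unitary:
  fixes V :: "complex^'n^'n"
  assumes V: "contraction V" and d: "norm (det V) = 1"
  shows "unitary_matrix V" and "norm (V *v x) = norm x"
proof -
  let ?A = "conj_transpose V ** V"
  have iso: "norm (?A *v x) = norm x" for x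
    using V d
    by (intro hermitian_contraction_isometry contraction_mult contraction_conj_transpose)
      (simp_all add: conj_transpose_mult det_mul norm_mult det_conj_transpose)
  have nV: "norm (V *v x) = norm x" for x
  proof -
    have "norm (?A *v x) \<le> norm (V *v x)"
      by (metis V contractionD contraction_conj_transpose matrix_vector_mul_assoc)
    then show ?thesis using iso[of x] contractionD[OF V, of x] by simp
  qed
  then show "norm (V *v x) = norm x" .
  have "?A *v x = mat 1 *v x" for x
  proof -
    have "(?A *v x) \<bullet> x = Re (cinner (V *v x) (V *v x))"
      unfolding Re_cinner[symmetric] 
      by (simp add: matrix_vector_mul_assoc[symmetric] cinner_adjoint)
    also have "\<dots> = (norm x)\<^sup>2" by (simp add: cinner_self nV)
    finally have "(norm (?A *v x - x))\<^sup>2 = 0"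
      using arg_cong[OF iso[of x], of "\<lambda>s. s\<^sup>2"] by (simp add: power2_norm_eq_inner inner_diff_left inner_diff_right inner_commute)
    then show ?thesis by simp
  qed
  then have "?A = mat 1" by (subst matrix_eq) blast
  then show "unitary_matrix V"
    unfolding unitary_matrix_def using matrix_left_right_inverse by blast
qed

section \<open>Blaschke factors and the Schwarz lemma\<close>

text \<open>The maximum principle on circles of radius tending to 1. The bound may depend on the
  radius as long as it tends to \<open>c\<close>, so no boundary values of \<open>f\<close>
  enter.\<close>

lemma norm_le_of_circle_bounds:
  fixes f :: "complex \<Rightarrow> complex"
  assumes f: "f holomorphic_on ball 0 1"
    and lim: "(B \<longlongrightarrow> c) (at_left 1)"
    and bd: "\<And>r w. 0 < r \<Longrightarrow> r < 1 \<Longrightarrow> norm w = r \<Longrightarrow> r0 < r \<Longrightarrow> norm (f w) \<le> B r"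
    and r0: "r0 < 1" and z: "norm z < 1"
  shows "norm (f z) \<le> (c :: real)"
proof (rule tendsto_lowerbound[OF lim])
  have "eventually (\<lambda>r::real. max (max r0 (norm z)) 0 < r) (at_left 1)"
    by (rule eventually_at_leftI[of "max (max r0 (norm z)) 0"]) (use r0 z in auto)
  moreover have "eventually (\<lambda>r::real. r < 1) (at_left 1)"
    by (simp add: eventually_at_filter)
  ultimately show "eventually (\<lambda>r. norm (f z) \<le> B r) (at_left 1)"
  proof eventually_elim
    case (elim r)
    show ?case
    proof (rule maximum_modulus_frontier[of f "ball 0 r"])
      show "f holomorphic_on interior (ball 0 r)"
        using elim by (auto intro: holomorphic_on_subset[OF f])
      show "continuous_on (closure (ball 0 r)) f"
        using elim by (auto intro!: holomorphic_on_imp_continuous_on holomorphic_on_subset[OF f])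
      show "norm (f w) \<le> B r" if "w \<in> frontier (ball 0 r)" for w
        using that elim by (intro bd) auto
    qed (use elim in auto)
  qed
qed simp

lemma one_minus_cnj_mult_bounds:
  assumes "norm a < 1" "norm z < 1"
  shows "1 - norm z \<le> norm (1 - cnj a * z)" and "norm (1 - cnj a * z) \<le> 2"
    and "1 - cnj a * z \<noteq> 0"
proof -
  have az: "norm (cnj a * z) \<le> norm z" "norm (cnj a * z) < 1"
    using assms mult_left_le_one_le[of "norm z" "norm a"] by (auto simp: norm_mult)
  show "1 - norm z \<le> norm (1 - cnj a * z)"
    using norm_triangle_ineq2[of 1 "cnj a * z"] az by simp
  show "norm (1 - cnj a * z) \<le> 2"
    using norm_triangle_ineq4[of 1 "cnj a * z"] az by simp
  show "1 - cnj a * z \<noteq> 0"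
    using az by (metis eq_iff_diff_eq_0 less_irrefl norm_one)
qed

lemma one_minus_norm_moebius:
  assumes "norm a < 1" "norm z < 1"
  shows "1 - (norm ((a - z) / (1 - cnj a * z)))\<^sup>2 =
    (1 - (norm a)\<^sup>2) * (1 - (norm z)\<^sup>2) / (norm (1 - cnj a * z))\<^sup>2"
proof -
  have "(norm (1 - cnj a * z))\<^sup>2 - (norm (a - z))\<^sup>2 = (1 - (norm a)\<^sup>2) * (1 - (norm z)\<^sup>2)"
    unfolding cmod_power2 by (simp add: power2_eq_square algebra_simps)
  then show ?thesis
    using one_minus_cnj_mult_bounds(3)[OF assms]
    by (simp add: norm_divide power_divide field_simps)
qed

lemma norm_blaschke_factor:
  "norm (blaschke_factor a z) = norm ((a - z) / (1 - cnj a * z))"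
  by (simp add: blaschke_factor_def norm_mult norm_divide)

lemma one_minus_norm_blaschke_factor:
  assumes "norm a < 1" "norm z < 1"
  shows "1 - (norm (blaschke_factor a z))\<^sup>2 =
    (1 - (norm a)\<^sup>2) * (1 - (norm z)\<^sup>2) / (norm (1 - cnj a * z))\<^sup>2"
  unfolding norm_blaschke_factor by (rule one_minus_norm_moebius[OF assms])

lemma norm_blaschke_factor_less_1:
  assumes "norm a < 1" "norm z < 1"
  shows "norm (blaschke_factor a z) < 1"
proof -
  have "(norm a)\<^sup>2 < 1" "(norm z)\<^sup>2 < 1"
    using assms by (simp_all add: power_less_one_iff)
  then have "0 < 1 - (norm (blaschke_factor a z))\<^sup>2"
    unfolding one_minus_norm_blaschke_factor[OF assms]
    using one_minus_cnj_mult_bounds(3)[OF assms] by (intro divide_pos_pos mult_pos_pos) auto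
  then show ?thesis
    by (simp add: power_less_one_iff)
qed

text \<open>Converts information at a single point \<open>z\<close> into the Blaschke condition on
  the zeros. The 8 is 4 times 2: the squared denominator is at most 4, and
  \<open>1 + norm (blaschke_factor a z)\<close> is at most 2.\<close>

lemma one_minus_norm_blaschke_factor_ge:
  assumes "norm a < 1" "norm z < 1"
  shows "(1 - norm a) * ((1 - (norm z)\<^sup>2) / 8) \<le> 1 - norm (blaschke_factor a z)"
proof -
  let ?b = "norm (blaschke_factor a z)" and ?w = "norm (1 - cnj a * z)"
  have z2: "(norm z)\<^sup>2 < 1"
    using assms by (simp add: power_less_one_iff)
  have a2: "(norm a)\<^sup>2 \<le> norm a"
    using assms by (simp add: power2_eq_square mult_left_le_one_le)
  have w: "0 < ?w" "?w\<^sup>2 \<le> 4"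
    using one_minus_cnj_mult_bounds[OF assms] power_mono[of ?w 2 2] by auto
  have "(1 - norm a) * (1 - (norm z)\<^sup>2) / 4 \<le> (1 - (norm a)\<^sup>2) * (1 - (norm z)\<^sup>2) / ?w\<^sup>2"
    using a2 z2 w assms by (intro frac_le mult_right_mono mult_nonneg_nonneg) auto
  also have "\<dots> = (1 - ?b) * (1 + ?b)"
    unfolding one_minus_norm_blaschke_factor[OF assms, symmetric]
    by (simp add: power2_eq_square algebra_simps)
  also have "\<dots> \<le> (1 - ?b) * 2"
    using norm_blaschke_factor_less_1[OF assms] by (intro mult_left_mono) auto
  finally show ?thesis by simp
qed

text \<open>The normalization by |a|/a is what brings the factor close to 1 when |a| is close to 1:
  after clearing denominators, \<open>1 - norm a\<close> splits off the numerator. This makes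
  infinite products converge.\<close>

lemma norm_blaschke_factor_minus_1_le:
  assumes "norm a < 1" "norm z < 1"
  shows "norm (blaschke_factor a z - 1) \<le> (1 - norm a) * (2 / (1 - norm z))"
proof (cases "a = 0")
  case True
  have "norm (z - 1) \<le> 2" using norm_triangle_ineq4[of z 1] assms by simp
  also have "2 \<le> 2 / (1 - norm z)" using assms by (simp add: field_simps)
  finally show ?thesis using True by (simp add: blaschke_factor_def)
next
  case False
  let ?w = "1 - cnj a * z"
  note w = one_minus_cnj_mult_bounds[OF assms]
  have sq: "of_real (norm a) * of_real (norm a) = a * cnj a"
    using complex_norm_square[of a] by (simp add: power2_eq_square)
  have "(of_real (norm a) * (a - z) - a * ?w) = of_real (norm a) * a - of_real (norm a) * z - a + (a * cnj a) * z"
    by (simp add: algebra_simps)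
  also have "\<dots> = - (1 - of_real (norm a)) * (a + of_real (norm a) * z)"
    unfolding sq[symmetric] by (simp add: algebra_simps)
  finally have num: "(of_real (norm a) * (a - z) - a * ?w) = - (1 - of_real (norm a)) * (a + of_real (norm a) * z)" .
  have "blaschke_factor a z - 1 = of_real (norm a) * (a - z) / (a * ?w) - a * ?w / (a * ?w)"
    using False w(3) by (simp add: blaschke_factor_def)
  then have "blaschke_factor a z - 1 = - (1 - of_real (norm a)) * (a + of_real (norm a) * z) / (a * ?w)"
    by (simp only: num diff_divide_distrib[symmetric])
  then have "norm (blaschke_factor a z - 1) =
      norm (complex_of_real (1 - norm a)) * norm (a + of_real (norm a) * z) / (norm a * norm ?w)"
    by (simp only: norm_mult norm_divide norm_minus_cancel of_real_diff of_real_1)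
  then have "norm (blaschke_factor a z - 1) =
      (1 - norm a) * (norm (a + of_real (norm a) * z) / (norm a * norm ?w))"
    using assms by (simp only: norm_of_real) simp
  also have "\<dots> \<le> (1 - norm a) * (2 * norm a / (norm a * (1 - norm z)))"
  proof (intro mult_left_mono frac_le)
    show "norm (a + of_real (norm a) * z) \<le> 2 * norm a"
      using norm_triangle_ineq[of a "of_real (norm a) * z"] assms mult_left_le[of "norm z" "norm a"]
      by (simp add: norm_mult)
  qed (use False assms w in auto)
  finally show ?thesis using False by simp
qed

lemma blaschke_factor_0_iff:
  assumes "norm a < 1" "norm z < 1"
  shows "blaschke_factor a z = 0 \<longleftrightarrow> z = a"
  using one_minus_cnj_mult_bounds(3)[OF assms] by (auto simp: blaschke_factor_def)

lemma blaschke_factor_holomorphic: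
  assumes "norm a < 1"
  shows "blaschke_factor a holomorphic_on ball 0 1"
proof (cases "a = 0")
  case True
  then show ?thesis by (simp add: blaschke_factor_def[abs_def])
next
  case False
  have "(\<lambda>z. of_real (norm a) / a * ((a - z) / (1 - cnj a * z))) holomorphic_on ball 0 1"
    using one_minus_cnj_mult_bounds(3)[OF assms] by (intro holomorphic_intros) auto
  then show ?thesis using False by (simp add: blaschke_factor_def[abs_def])
qed

text \<open>\<open>|b\<^sub>a| \<rightarrow> 1\<close> uniformly at the boundary, so dividing by \<open>b\<^sub>a\<close> does not increase the bound.\<close>
lemma norm_le_of_blaschke_factor_mult_le:
  fixes q :: "complex \<Rightarrow> complex"
  assumes q: "q holomorphic_on ball 0 1" and a: "norm a < 1"
    and bd: "\<And>z. norm z < 1 \<Longrightarrow> norm (blaschke_factor a z * q z) \<le> c"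
    and z: "norm z < 1"
  shows "norm (q z) \<le> c"
proof -
  \<comment> \<open>A lower bound for the Blaschke factor on the circle of radius \<open>r\<close>,
    from the Moebius identity and |1 - cnj a w| \<ge> 1 - |a|. For small \<open>r\<close> the
    radicand may be negative; only radii near 1, where it is positive, are used.\<close>
  define \<beta> where "\<beta> r = sqrt (1 - (1 - r\<^sup>2) / (1 - norm a)\<^sup>2)" for r :: real
  have c: "0 \<le> c" using bd[of 0] order_trans[OF norm_ge_zero] by fastforce
  have \<beta>1: "(\<beta> \<longlongrightarrow> \<beta> 1) (at_left 1)"
    unfolding \<beta>_def by (intro tendsto_intros) (use a in auto)
  moreover have "\<beta> 1 = 1" by (simp add: \<beta>_def)
  ultimately have lim: "((\<lambda>r. c / \<beta> r) \<longlongrightarrow> c) (at_left 1)"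
    using tendsto_divide[OF tendsto_const, of \<beta> "\<beta> 1" "at_left 1" c] by simp
  have "eventually (\<lambda>r. 0 < \<beta> r) (at_left 1)"
    by (rule order_tendstoD(1)[OF \<beta>1]) (simp add: \<beta>_def)
  then obtain r0 where r0: "r0 < 1" "\<And>r. r0 < r \<Longrightarrow> r < 1 \<Longrightarrow> 0 < \<beta> r"
    by (auto simp: eventually_at_left_field)
  show ?thesis
  proof (rule norm_le_of_circle_bounds[OF q lim _ r0(1) z])
    fix r :: real and w :: complex assume r: "0 < r" "r < 1" "norm w = r" "r0 < r"
    then have w: "norm w < 1" by simp
    have "1 - norm a \<le> norm (1 - cnj a * w)"
      using norm_triangle_ineq2[of 1 "cnj a * w"] mult_left_le[of "norm w" "norm a"] w
      by (simp add: norm_mult)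
    then have wa: "(1 - norm a)\<^sup>2 \<le> (norm (1 - cnj a * w))\<^sup>2"
      using a by (intro power_mono) auto
    have "1 - (norm (blaschke_factor a w))\<^sup>2 \<le> (1 - r\<^sup>2) / (1 - norm a)\<^sup>2"
      unfolding one_minus_norm_blaschke_factor[OF a w]
      using r w a wa power_le_one[of "norm w" 2] power_le_one[of "norm a" 2]
      by (intro frac_le) (auto simp: mult_left_le_one_le)
    then have "\<beta> r \<le> norm (blaschke_factor a w)"
      unfolding \<beta>_def by (intro real_le_lsqrt) auto
    then have "\<beta> r * norm (q w) \<le> norm (blaschke_factor a w) * norm (q w)"
      by (rule mult_right_mono) simp
    also have "\<dots> \<le> c"
      using bd[OF w] by (simp add: norm_mult)
    finally have "\<beta> r * norm (q w) \<le> c" .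
    then show "norm (q w) \<le> c / \<beta> r"
      using r0(2)[of r] r by (simp add: field_simps)
  qed
qed

lemma divide_by_blaschke_factor:
  assumes h: "h holomorphic_on ball 0 1" and a: "norm a < 1" and ha: "h a = 0"
  obtains q where "q holomorphic_on ball 0 1" "\<And>z. norm z < 1 \<Longrightarrow> h z = blaschke_factor a z * q z"
proof
  \<comment> \<open>\<open>p\<close> removes the singularity of the difference quotient at
    \<open>a\<close>, and \<open>k\<close> is the zero-free cofactor of \<open>z - a\<close> in the
    Blaschke factor; their quotient is the required function.\<close>
  define p where "p z = (if z = a then deriv h a else (h z - h a) / (z - a))" for z
  define k where "k z = (if a = 0 then 1 else - (of_real (norm a) / a) / (1 - cnj a * z))" for z
  have "p holomorphic_on ball 0 1"
    unfolding p_def[abs_def] by (rule pole_lemma_open[OF h]) simp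
  moreover have "k holomorphic_on ball 0 1"
    unfolding k_def[abs_def] using one_minus_cnj_mult_bounds(3)[OF a]
    by (cases "a = 0") (auto intro!: holomorphic_intros)
  moreover have k: "k z \<noteq> 0" if "norm z < 1" for z
    using one_minus_cnj_mult_bounds(3)[OF a that] by (auto simp: k_def)
  ultimately show "(\<lambda>z. p z / k z) holomorphic_on ball 0 1"
    by (intro holomorphic_intros) auto
  fix z :: complex assume z: "norm z < 1"
  have "blaschke_factor a z = (z - a) * k z"
  proof -
    have "X * ((a - z) / w) = (z - a) * (- X / w)" for X w
      by (simp add: algebra_simps diff_divide_distrib)
    then show ?thesis by (simp add: k_def blaschke_factor_def)
  qed
  moreover have "h z = (z - a) * p z"
    using ha by (auto simp: p_def)
  ultimately show "h z = blaschke_factor a z * (p z / k z)"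
    using k[OF z] by simp
qed

section \<open>The lemmas of Schwarz and Schwarz-Pick\<close>

lemma blaschke_factor_at_0: "blaschke_factor 0 z = z"
  by (simp add: blaschke_factor_def)

lemma schwarz_le:
  assumes h: "h holomorphic_on ball 0 1" and h0: "h 0 = 0"
    and bd: "\<And>z. norm z < 1 \<Longrightarrow> norm (h z) \<le> c" and z: "norm z < 1"
  shows "norm (h z) \<le> norm z * c"
proof -
  obtain q where q: "q holomorphic_on ball 0 1" "\<And>z. norm z < 1 \<Longrightarrow> h z = blaschke_factor 0 z * q z"
    using divide_by_blaschke_factor[OF h _ h0] by auto
  have "norm (q z) \<le> c"
    using norm_le_of_blaschke_factor_mult_le[OF q(1), of 0 c z] q(2) bd z by auto
  then show ?thesis
    using q(2)[OF z] by (simp add: norm_mult blaschke_factor_at_0 mult_left_mono)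
qed

lemma schwarz_pick_at_0:
  assumes f: "f holomorphic_on ball 0 1"
    and bd: "\<And>z. norm z < 1 \<Longrightarrow> norm (f z) \<le> 1" and z: "norm z < 1"
  shows "norm (f z - f 0) * (1 - norm z) \<le> 1 - (norm (f 0))\<^sup>2"
proof -
  define c where "c = f 0"
  have c1: "norm c \<le> 1" using bd[of 0] by (simp add: c_def)
  \<comment> \<open>Shrinking by \<rho> < 1 keeps the values strictly inside the disc, so the
    Moebius map is available even if \<open>f\<close> attains modulus 1; afterwards \<rho> tends to
    1.\<close>
  have ev: "norm (of_real \<rho> * (f z - c)) \<le> norm z * norm (1 - of_real (\<rho>\<^sup>2) * cnj c * f z)"
    if \<rho>: "0 < \<rho>" "\<rho> < 1" for \<rho> :: real
  proof -
    define a where "a = of_real \<rho> * c"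
    have "\<rho> * norm c \<le> \<rho> * 1" using \<rho> c1 by (intro mult_left_mono) auto
    also have "\<dots> < 1" using \<rho> by simp
    finally have a: "norm a < 1" using \<rho> by (simp add: a_def norm_mult)
    have fw: "norm (of_real \<rho> * f w) < 1" if "norm w < 1" for w
    proof -
      have "\<rho> * norm (f w) \<le> \<rho> * 1" using \<rho> bd[OF that] by (intro mult_left_mono) auto
      also have "\<dots> < 1" using \<rho> by simp
      finally show ?thesis using \<rho> by (simp add: norm_mult)
    qed
    note w = one_minus_cnj_mult_bounds(3)[OF a fw]
    define G where "G w = (a - of_real \<rho> * f w) / (1 - cnj a * (of_real \<rho> * f w))" for w
    have "norm (G z) \<le> norm z * 1"
    proof (rule schwarz_le)
      show "G holomorphic_on ball 0 1"
        unfolding G_def[abs_def] using w f by (intro holomorphic_intros) auto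
      show "G 0 = 0" by (simp add: G_def a_def c_def)
      show "norm (G w) \<le> 1" if "norm w < 1" for w
        using norm_blaschke_factor_less_1[OF a fw[OF that]]
        unfolding norm_blaschke_factor G_def by simp
    qed (fact z)
    then have "norm (a - of_real \<rho> * f z) \<le> norm z * norm (1 - cnj a * (of_real \<rho> * f z))"
      using w[OF z] by (simp add: G_def norm_divide field_simps)
    moreover have "norm (a - of_real \<rho> * f z) = norm (of_real \<rho> * (f z - c))"
      by (simp add: a_def norm_minus_commute flip: right_diff_distrib) (simp add: norm_mult norm_minus_commute)
    moreover have "cnj a * (of_real \<rho> * f z) = of_real (\<rho>\<^sup>2) * cnj c * f z"
      by (simp add: a_def power2_eq_square)
    ultimately show ?thesis by simp
  qed
  have "norm (of_real 1 * (f z - c)) \<le> norm z * norm (1 - of_real (1\<^sup>2) * cnj c * f z)"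
  proof (rule tendsto_le[of "at_left (1::real)"])
    show "((\<lambda>\<rho>. norm (of_real \<rho> * (f z - c))) \<longlongrightarrow> norm (of_real 1 * (f z - c))) (at_left (1::real))"
      by (intro tendsto_intros)
    show "((\<lambda>\<rho>. norm z * norm (1 - of_real (\<rho>\<^sup>2) * cnj c * f z)) \<longlongrightarrow>
        norm z * norm (1 - of_real (1\<^sup>2) * cnj c * f z)) (at_left (1::real))"
      by (intro tendsto_intros)
    show "eventually (\<lambda>\<rho>. norm (of_real \<rho> * (f z - c)) \<le> norm z * norm (1 - of_real (\<rho>\<^sup>2) * cnj c * f z))
        (at_left (1::real))"
      by (rule eventually_at_leftI[of 0]) (use ev in auto)
  qed simp
  \<comment> \<open>Rewritten so that \<open>f z - c\<close> reappears on the right; carrying the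
    factor \<open>norm z\<close> < 1, it can be absorbed into the left side.\<close>
  also have "1 - of_real (1\<^sup>2) * cnj c * f z = of_real (1 - (norm c)\<^sup>2) - cnj c * (f z - c)"
    unfolding of_real_diff complex_norm_square by (simp add: algebra_simps)
  also have "norm \<dots> \<le> (1 - (norm c)\<^sup>2) + norm (f z - c)"
  proof -
    have "norm (of_real (1 - (norm c)\<^sup>2) - cnj c * (f z - c)) \<le>
        norm (complex_of_real (1 - (norm c)\<^sup>2)) + norm (cnj c * (f z - c))"
      by (rule norm_triangle_ineq4)
    also have "\<dots> \<le> (1 - (norm c)\<^sup>2) + norm (f z - c)"
      using c1 power_le_one[of "norm c" 2] mult_right_mono[of "norm c" 1 "norm (f z - c)"]
      unfolding norm_of_real norm_mult complex_mod_cnj by (intro add_mono) simp_all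
    finally show ?thesis .
  qed
  finally have "norm (f z - c) \<le> norm z * ((1 - (norm c)\<^sup>2) + norm (f z - c))"
    using z by (simp add: mult_left_mono)
  also have "\<dots> \<le> (1 - (norm c)\<^sup>2) + norm z * norm (f z - c)"
    using z c1 power_le_one[of "norm c" 2] by (simp add: distrib_left mult_left_le_one_le)
  finally show ?thesis by (simp add: c_def algebra_simps)
qed

section \<open>Blaschke--Potapov factors\<close>

definition rank_one_projection :: "complex^'n \<Rightarrow> complex^'n^'n" where
  "rank_one_projection v = (\<chi> i j. v $ i * cnj (v $ j))"

lemma rank_one_projection_vector: "rank_one_projection v *v x = cinner x v *s v"
  by (simp add: rank_one_projection_def matrix_vector_mult_def cinner_def vec_eq_iff sum_distrib_left mult_ac)

lemma sum_mult_cnj_unit: "norm (v :: complex^'n) = 1 \<Longrightarrow> (\<Sum>i\<in>UNIV. v $ i * cnj (v $ i)) = 1"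
  using cinner_self[of v] by (simp add: cinner_def)

lemma rank_one_projection:
  assumes "norm v = 1"
  shows "orthogonal_projection (rank_one_projection v)" and "trace (rank_one_projection v) = 1"
    and "rank_one_projection v \<noteq> 0"
proof -
  have "(\<Sum>k\<in>UNIV. v $ i * cnj (v $ k) * (v $ k * cnj (v $ j))) =
      v $ i * (\<Sum>k\<in>UNIV. v $ k * cnj (v $ k)) * cnj (v $ j)" for i j
    by (simp add: sum_distrib_left sum_distrib_right mult_ac)
  then show "orthogonal_projection (rank_one_projection v)"
    by (simp add: orthogonal_projection_def rank_one_projection_def conj_transpose_def
        matrix_matrix_mult_def vec_eq_iff sum_mult_cnj_unit[OF assms])
  show tr: "trace (rank_one_projection v) = 1"
    by (simp add: trace_def rank_one_projection_def sum_mult_cnj_unit[OF assms])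
  show "rank_one_projection v \<noteq> 0"
    using tr by (auto simp: trace_def)
qed

section \<open>Contractivity and determinants of the elementary factors\<close>

lemma mat_mult_entry: "(mat c ** A) $ i $ j = c * A $ i $ j"
proof -
  have "(mat c ** A) $ i $ j = (\<Sum>k\<in>UNIV. if i = k then c * A $ k $ j else 0)"
    unfolding matrix_matrix_mult_def mat_def vec_lambda_beta by (rule sum.cong) auto
  then show ?thesis by simp
qed

lemma mat_entry: "mat c $ i $ j = (if i = j then c else 0)"
  by (simp add: mat_def)

lemma mat_mult_vector: "mat c *v x = c *s x"
proof -
  have "(mat c *v x) $ i = (\<Sum>k\<in>UNIV. if i = k then c * x $ k else 0)" for i
    unfolding matrix_vector_mult_def mat_def vec_lambda_beta by (rule sum.cong) auto
  then show ?thesis by (simp add: vec_eq_iff)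
qed

lemma bp_factor_vector:
  "bp_factor a (rank_one_projection v) z *v x = x + (blaschke_factor a z - 1) *s (cinner x v *s v)"
  by (simp add: bp_factor_def matrix_vector_mult_add_rdistrib matrix_vector_mul_assoc[symmetric]
      mat_mult_vector rank_one_projection_vector del: vector_smult_assoc)

text \<open>Pythagoras for the components orthogonal and parallel to \<open>v\<close>. It serves
  twice: with scalars 1 and b for the elementary factor, and with b and 1 for b times its
  inverse.\<close>

lemma norm_split_scale_le:
  assumes v: "norm v = 1" and "norm \<alpha> \<le> 1" "norm \<beta> \<le> 1"
  shows "norm (\<alpha> *s (x - cinner x v *s v) + \<beta> *s (cinner x v *s v)) \<le> norm (x :: complex^'n)"
proof -
  define p where "p = cinner x v *s v"
  define w where "w = x - p"
  have "cinner v v = 1" using v by (simp add: cinner_self)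
  then have "cinner w v = 0" by (simp add: w_def p_def cinner_diff_left cinner_scale_left)
  then have orth: "cinner (c *s w) (d *s p) = 0" for c d
    by (simp add: p_def cinner_scale_left cinner_scale_right)
  have pyth: "(norm (c *s w + d *s p))\<^sup>2 = (norm c * norm w)\<^sup>2 + (norm d * norm p)\<^sup>2" for c d
    using norm_add_Pythagorean[of "c *s w" "d *s p"] orth[of c d]
    by (simp add: orthogonal_def Re_cinner[symmetric] norm_vector_scale)
  have "(norm (\<alpha> *s w + \<beta> *s p))\<^sup>2 \<le> (norm w)\<^sup>2 + (norm p)\<^sup>2"
    unfolding pyth using assms by (intro add_mono power_mono) (auto simp: mult_left_le_one_le)
  also have "\<dots> = (norm (1 *s w + 1 *s p))\<^sup>2"
    unfolding pyth by simp
  also have "1 *s w + 1 *s p = x" by (simp add: w_def)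
  finally show ?thesis unfolding p_def w_def by (rule power2_le_imp_le) simp
qed

lemma bp_factor_vector':
  "bp_factor a (rank_one_projection v) z *v x =
    1 *s (x - cinner x v *s v) + blaschke_factor a z *s (cinner x v *s v)"
  unfolding bp_factor_vector by (simp add: vec_eq_iff algebra_simps)

lemma contraction_bp_factor:
  assumes "norm v = 1" "norm a < 1" "norm z < 1"
  shows "contraction (bp_factor a (rank_one_projection v) z)"
  unfolding contraction_def bp_factor_vector'
  using assms norm_blaschke_factor_less_1[of a z] by (intro allI norm_split_scale_le) auto

lemma holomorphic_on_det:
  assumes "\<And>i j. (\<lambda>z. M z $ i $ j) holomorphic_on S"
  shows "(\<lambda>z. det (M z)) holomorphic_on S"
  unfolding det_def using assms by (intro holomorphic_intros) 

text \<open>A power trick: all powers of \<open>A\<close> are contractions, so the powers of its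
  determinant stay below a fixed constant, which excludes modulus greater than 1.\<close>

lemma norm_det_contraction_le_1:
  fixes A :: "complex^'n^'n"
  assumes A: "contraction A"
  shows "norm (det A) \<le> 1"
proof (rule ccontr)
  assume "\<not> ?thesis"
  then have gt: "1 < norm (det A)" by simp
  define M where "M k = (((**) A) ^^ k) (mat 1)" for k
  have "contraction (M k) \<and> det (M k) = det A ^ k" for k
    by (induction k) (simp_all add: M_def contraction_mat_1 contraction_mult A det_mul)
  then have "norm (det A) ^ k \<le> fact CARD('n)" for k
    using norm_det_le_fact[of "M k"] contraction_entry_le[of "M k"] by (metis norm_power)
  with real_arch_pow[OF gt, of "fact CARD('n)"] show False by (meson not_less)
qed

text \<open>As a polynomial in \<open>x\<close>, \<open>det (I + (x - 1) P)\<close> is bounded by 1 on the disc and vanishes at 0,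
  so that the Schwarz lemma applies.\<close>
lemma norm_det_bp_factor_le:
  fixes v :: "complex^'n"
  assumes v: "norm v = 1" and a: "norm a < 1" and z: "norm z < 1"
  shows "norm (det (bp_factor a (rank_one_projection v) z)) \<le> norm (blaschke_factor a z)"
proof -
  have vec: "bp_factor 0 (rank_one_projection v) 0 *v v = 0"
    by (simp add: bp_factor_vector cinner_self v blaschke_factor_def vec_eq_iff)
  have "v \<noteq> 0" using v by auto
  with vec have d0: "det (bp_factor 0 (rank_one_projection v) 0) = 0"
    by (metis invertible_det_nz invertible_left_inverse matrix_left_invertible_ker)
  have "norm (det (bp_factor 0 (rank_one_projection v) (blaschke_factor a z))) \<le>
      norm (blaschke_factor a z) * 1"
  proof (rule schwarz_le)
    show "(\<lambda>x. det (bp_factor 0 (rank_one_projection v) x)) holomorphic_on ball 0 1"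
      by (intro holomorphic_on_det)
        (auto simp: bp_factor_def mat_mult_entry blaschke_factor_at_0 intro!: holomorphic_intros)
    show "norm (det (bp_factor 0 (rank_one_projection v) x)) \<le> 1" if "norm x < 1" for x
      using v that by (intro norm_det_contraction_le_1 contraction_bp_factor) auto
  qed (use d0 norm_blaschke_factor_less_1[OF a z] in auto)
  then show ?thesis by (simp add: bp_factor_def blaschke_factor_at_0)
qed

lemma matrix_holomorphic_det: "matrix_holomorphic M \<Longrightarrow> (\<lambda>z. det (M z)) holomorphic_on ball 0 1"
  by (auto simp: matrix_holomorphic_def intro!: holomorphic_on_det)

lemma matrix_holomorphic_mult:
  "matrix_holomorphic A \<Longrightarrow> matrix_holomorphic B \<Longrightarrow> matrix_holomorphic (\<lambda>z. A z ** B z)"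
  unfolding matrix_holomorphic_def matrix_matrix_mult_def by (auto intro!: holomorphic_intros)

lemma matrix_holomorphic_bp_factor:
  assumes "norm a < 1"
  shows "matrix_holomorphic (bp_factor a P)"
  using blaschke_factor_holomorphic[OF assms]
  by (auto simp: matrix_holomorphic_def bp_factor_def mat_mult_entry intro!: holomorphic_intros)

lemma holomorphic_on_cinner:
  assumes "matrix_holomorphic M"
  shows "(\<lambda>z. cinner (M z *v x) y) holomorphic_on ball 0 1"
  using assms unfolding matrix_holomorphic_def cinner_def matrix_vector_mult_def
  by (auto intro!: holomorphic_intros)

text \<open>With \<open>v\<close> orthogonal to the range of \<open>\<Theta> a\<close>, all entries of
  \<open>(b I + (1 - b) v v\<^sup>*) \<Theta>\<close>, which is \<open>b B\<^sup>-\<^sup>1 \<Theta>\<close>, are divisible by \<open>b\<close>.\<close>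
lemma split_off_bp_factor:
  fixes \<Theta> :: "complex \<Rightarrow> complex^'n^'n"
  assumes hol: "matrix_holomorphic \<Theta>" and con: "\<And>z. norm z < 1 \<Longrightarrow> contraction (\<Theta> z)"
    and a: "norm a < 1" and det: "det (\<Theta> a) = 0"
  obtains v \<Theta>' where "norm v = 1" "matrix_holomorphic \<Theta>'" "\<And>z. norm z < 1 \<Longrightarrow> contraction (\<Theta>' z)"
    "\<And>z. norm z < 1 \<Longrightarrow> \<Theta> z = bp_factor a (rank_one_projection v) z ** \<Theta>' z"
proof -
  let ?b = "blaschke_factor a"
  have "det (conj_transpose (\<Theta> a)) = 0" using det by (simp add: det_conj_transpose)
  then obtain u where u: "u \<noteq> 0" "conj_transpose (\<Theta> a) *v u = 0"
    by (metis invertible_det_nz invertible_left_inverse matrix_left_invertible_ker)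
  define v where "v = of_real (inverse (norm u)) *s u"
  have v: "norm v = 1" using u by (simp add: v_def norm_vector_scale norm_inverse)
  have va: "cinner (\<Theta> a *v x) v = 0" for x
    by (simp add: cinner_adjoint v_def vec.scale u cinner_scale_right) (simp add: cinner_def)
  define H where "H z = (mat (?b z) + mat (1 - ?b z) ** rank_one_projection v) ** \<Theta> z" for z
  have Hx: "H z *v x = ?b z *s (\<Theta> z *v x - cinner (\<Theta> z *v x) v *s v) + 1 *s (cinner (\<Theta> z *v x) v *s v)" for z x
    unfolding H_def
    by (simp add: matrix_vector_mult_add_rdistrib matrix_vector_mul_assoc[symmetric]
      mat_mult_vector rank_one_projection_vector del: vector_smult_assoc)
      (simp add: vec_eq_iff algebra_simps)
  have bpH: "bp_factor a (rank_one_projection v) z *v (H z *v x) = ?b z *s (\<Theta> z *v x)" for z x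
  proof -
    define y c where "y = \<Theta> z *v x" and "c = cinner y v"
    have "cinner v v = 1" using v by (simp add: cinner_self)
    then have "cinner (H z *v x) v = c"
      unfolding Hx y_def[symmetric] c_def
      by (simp add: cinner_add_left cinner_diff_left cinner_scale_left)
    then show ?thesis
      unfolding bp_factor_vector Hx y_def[symmetric] c_def[symmetric]
      by (simp add: vec_eq_iff algebra_simps)
  qed
  have H_hol: "matrix_holomorphic H"
    unfolding H_def[abs_def]
  proof (rule matrix_holomorphic_mult[OF _ hol])
    have "(\<lambda>z. (if i = j then ?b z else 0) + (1 - ?b z) * c) holomorphic_on ball 0 1" for i j :: 'n and c
      using blaschke_factor_holomorphic[OF a] by (cases "i = j") (auto intro!: holomorphic_intros)
    then show "matrix_holomorphic (\<lambda>z. mat (?b z) + mat (1 - ?b z) ** rank_one_projection v)"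
      by (simp add: matrix_holomorphic_def mat_mult_entry mat_entry)
  qed
  have "H a *v x = 0" for x
    unfolding Hx va using blaschke_factor_0_iff[OF a a] by simp
  then have "H a = 0" by (subst matrix_eq) simp
  then have "\<exists>q. q holomorphic_on ball 0 1 \<and> (\<forall>z. norm z < 1 \<longrightarrow> H z $ i $ j = ?b z * q z)" for i j
    using divide_by_blaschke_factor[of "\<lambda>z. H z $ i $ j", OF _ a] H_hol
    unfolding matrix_holomorphic_def by (metis zero_index)
  then obtain Q where Q: "\<And>i j. Q i j holomorphic_on ball 0 1"
      "\<And>i j z. norm z < 1 \<Longrightarrow> H z $ i $ j = ?b z * Q i j z"
    by metis
  define \<Theta>' where "\<Theta>' z = (\<chi> i j. Q i j z)" for z
  have \<Theta>'_hol: "matrix_holomorphic \<Theta>'"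
    using Q(1) by (simp add: matrix_holomorphic_def \<Theta>'_def)
  have bT: "H z = mat (?b z) ** \<Theta>' z" if "norm z < 1" for z
    using Q(2)[OF that] by (simp add: vec_eq_iff mat_mult_entry \<Theta>'_def)
  then have bTx: "H z *v x = ?b z *s (\<Theta>' z *v x)" if "norm z < 1" for z x
    using that by (simp add: matrix_vector_mul_assoc[symmetric] mat_mult_vector)
  show ?thesis
  proof
    show "norm v = 1" "matrix_holomorphic \<Theta>'" by fact+
  next
    fix z :: complex assume z: "norm z < 1"
    \<comment> \<open>Entrywise division by b says nothing about norms. The bound is inherited from
      \<open>H\<close>, which is contractive, by removing b from the scalar functions
      \<open>cinner (\<Theta>' w *v x) y\<close>.\<close>
    show "contraction (\<Theta>' z)"
    proof (rule contractionI_cinner)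
      fix x y
      show "norm (cinner (\<Theta>' z *v x) y) \<le> norm x * norm y"
      proof (rule norm_le_of_blaschke_factor_mult_le[OF holomorphic_on_cinner[OF \<Theta>'_hol] a _ z])
        fix w :: complex assume w: "norm w < 1"
        have "norm (H w *v x) \<le> norm (\<Theta> w *v x)"
          unfolding Hx using norm_blaschke_factor_less_1[OF a w] v by (intro norm_split_scale_le) auto
        also have "\<dots> \<le> norm x" by (rule contractionD[OF con[OF w]])
        finally have "norm (cinner (H w *v x) y) \<le> norm x * norm y"
          by (meson mult_right_mono norm_cinner_le norm_ge_zero order_trans)
        then show "norm (?b w * cinner (\<Theta>' w *v x) y) \<le> norm x * norm y"
          by (simp add: bTx[OF w] cinner_scale_left)
      qed
    qed
    let ?g = "\<lambda>z. bp_factor a (rank_one_projection v) z ** \<Theta>' z"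
    \<comment> \<open>After multiplication by b both sides agree. Removing b through the division
      bound with constant 0 also covers the point \<open>a\<close>, where b vanishes.\<close>
    have "norm ((?g z - \<Theta> z) $ i $ j) \<le> 0" for i j
    proof (rule norm_le_of_blaschke_factor_mult_le[OF _ a _ z])
      show "(\<lambda>z. (?g z - \<Theta> z) $ i $ j) holomorphic_on ball 0 1"
        using matrix_holomorphic_mult[OF matrix_holomorphic_bp_factor[OF a] \<Theta>'_hol] hol
        by (auto simp: matrix_holomorphic_def intro!: holomorphic_intros)
      fix w :: complex assume w: "norm w < 1"
      have "(mat (?b w) ** ?g w) *v x = (mat (?b w) ** \<Theta> w) *v x" for x
      proof -
        have "(mat (?b w) ** ?g w) *v x = ?b w *s (bp_factor a (rank_one_projection v) w *v (\<Theta>' w *v x))"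
          by (simp add: matrix_vector_mul_assoc[symmetric] mat_mult_vector)
        also have "\<dots> = bp_factor a (rank_one_projection v) w *v (H w *v x)"
          by (simp add: bTx[OF w] vec.scale)
        also have "\<dots> = (mat (?b w) ** \<Theta> w) *v x"
          unfolding bpH by (simp add: matrix_vector_mul_assoc[symmetric] mat_mult_vector)
        finally show ?thesis .
      qed
      then have "mat (?b w) ** ?g w = mat (?b w) ** \<Theta> w"
        by (subst matrix_eq) blast
      then have "?b w * ?g w $ i $ j = ?b w * \<Theta> w $ i $ j"
        by (metis mat_mult_entry)
      then show "norm (?b w * (?g w - \<Theta> w) $ i $ j) \<le> 0"
        by (simp add: algebra_simps)
    qed
    then show "\<Theta> z = ?g z" by (simp add: vec_eq_iff)
  qed
qed

section \<open>Splitting off Blaschke--Potapov factors\<close>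

lemma tendsto_matrixI:
  fixes A :: "'b \<Rightarrow> complex^'n^'n"
  assumes "\<And>j. ((\<lambda>k. A k *v axis j 1) \<longlongrightarrow> L *v axis j 1) F"
  shows "(A \<longlongrightarrow> L) F"
proof -
  have col: "(M *v axis j 1) $ i = M $ i $ j" for M :: "complex^'n^'n" and i j
    by (simp add: matrix_vector_mult_def axis_def if_distrib[of "\<lambda>u. _ * u"] cong: if_cong)
  show ?thesis
    by (intro vec_tendstoI) (use tendsto_vec_nth[OF assms] col in auto)
qed

lemma tendsto_matrix_vector_mult:
  fixes A :: "'b \<Rightarrow> complex^'n^'n"
  assumes "(A \<longlongrightarrow> L) F"
  shows "((\<lambda>k. A k *v x) \<longlongrightarrow> L *v x) F"
  unfolding matrix_vector_mult_def
  by (intro vec_tendstoI) (auto intro!: tendsto_intros tendsto_vec_nth assms)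

lemma tendsto_det:
  fixes A :: "'b \<Rightarrow> complex^'n^'n"
  assumes "(A \<longlongrightarrow> L) F"
  shows "((\<lambda>k. det (A k)) \<longlongrightarrow> det L) F"
  unfolding det_def by (intro tendsto_intros tendsto_vec_nth assms)

lemma contraction_limit:
  fixes A :: "nat \<Rightarrow> complex^'n^'n"
  assumes "A \<longlonglongrightarrow> L" "\<And>k. contraction (A k)"
  shows "contraction L"
  unfolding contraction_def
proof
  fix x
  have "(\<lambda>k. norm (A k *v x)) \<longlonglongrightarrow> norm (L *v x)"
    by (intro tendsto_norm tendsto_matrix_vector_mult assms)
  then show "norm (L *v x) \<le> norm x"
    by (rule LIMSEQ_le_const2) (use assms(2) in \<open>auto simp: contraction_def\<close>)
qed

lemma bounded_contractions: "bounded {A :: complex^'n^'n. contraction A}"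
proof (rule boundedI)
  fix A :: "complex^'n^'n" assume "A \<in> {A. contraction A}"
  then have A: "contraction A" by simp
  have "norm A \<le> (\<Sum>i\<in>UNIV. norm (A $ i))"
    unfolding norm_vec_def[of A] by (rule L2_set_le_sum) simp
  also have "\<dots> \<le> (\<Sum>i\<in>(UNIV :: 'n set). \<Sum>j\<in>(UNIV :: 'n set). 1)"
  proof (rule sum_mono)
    fix i
    have "norm (A $ i) \<le> (\<Sum>j\<in>UNIV. norm (A $ i $ j))"
      unfolding norm_vec_def[of "A $ i"] by (rule L2_set_le_sum) simp
    also have "\<dots> \<le> (\<Sum>j\<in>(UNIV :: 'n set). 1)"
      by (intro sum_mono contraction_entry_le A)
    finally show "norm (A $ i) \<le> (\<Sum>j\<in>(UNIV :: 'n set). 1)" .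
  qed
  finally show "norm A \<le> real CARD('n) * real CARD('n)" by simp
qed

text \<open>Schwarz--Pick in the direction of \<open>V x\<close>: a contraction-valued holomorphic function
  which is almost isometric at 0 is almost constant.\<close>
lemma contractions_tendsto_constant:
  fixes T :: "nat \<Rightarrow> complex \<Rightarrow> complex^'n^'n"
  assumes hol: "\<And>k. matrix_holomorphic (T k)"
    and con: "\<And>k z. norm z < 1 \<Longrightarrow> contraction (T k z)"
    and lim: "(\<lambda>k. T k 0) \<longlonglongrightarrow> V" and iso: "\<And>x. norm (V *v x) = norm x"
    and z: "norm z < 1"
  shows "(\<lambda>k. T k z) \<longlonglongrightarrow> V"
proof (rule tendsto_matrixI)
  fix j :: 'n
  define x :: "complex^'n" where "x = axis j 1"
  have x: "norm x = 1" "norm (V *v x) = 1" by (simp_all add: x_def iso norm_axis_1)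
  define f where "f k w = cinner (T k w *v x) (V *v x)" for k w
  have f_le: "norm (f k w) \<le> 1" if "norm w < 1" for k w
    using norm_cinner_le[of "T k w *v x" "V *v x"] contractionD[OF con[OF that], of k x] x
    by (simp add: f_def)
  have "(\<lambda>k. f k 0) \<longlonglongrightarrow> cinner (V *v x) (V *v x)"
    unfolding f_def cinner_def
    by (intro tendsto_intros tendsto_vec_nth tendsto_matrix_vector_mult lim)
  then have f0: "(\<lambda>k. f k 0) \<longlonglongrightarrow> 1" using x by (simp add: cinner_self)
  have "(\<lambda>k. f k z - f k 0) \<longlonglongrightarrow> 0"
  proof (rule Lim_null_comparison)
    show "(\<lambda>k. (1 - (norm (f k 0))\<^sup>2) / (1 - norm z)) \<longlonglongrightarrow> 0"
      using z by (auto intro!: tendsto_eq_intros f0)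
    show "eventually (\<lambda>k. norm (f k z - f k 0) \<le> (1 - (norm (f k 0))\<^sup>2) / (1 - norm z)) sequentially"
    proof (rule always_eventually, rule allI)
      fix k
      have "norm (f k z - f k 0) * (1 - norm z) \<le> 1 - (norm (f k 0))\<^sup>2"
        unfolding f_def
        by (rule schwarz_pick_at_0[OF holomorphic_on_cinner[OF hol] _ z])
          (use f_le in \<open>simp add: f_def\<close>)
      then show "norm (f k z - f k 0) \<le> (1 - (norm (f k 0))\<^sup>2) / (1 - norm z)"
        using z by (simp add: field_simps)
    qed
  qed
  from tendsto_add[OF this f0] have fz: "(\<lambda>k. f k z) \<longlonglongrightarrow> 1" by simp
  \<comment> \<open>So far only the component along \<open>V *v x\<close> is known to tend to 1. As
    the whole vector has norm at most 1, no room is left for the other components.\<close>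
  have "(\<lambda>k. T k z *v x - V *v x) \<longlonglongrightarrow> 0"
  proof (rule Lim_null_comparison)
    show "(\<lambda>k. sqrt (2 - 2 * Re (f k z))) \<longlonglongrightarrow> 0"
      by (rule tendsto_eq_intros tendsto_Re[OF fz] refl)+ simp
    show "eventually (\<lambda>k. norm (T k z *v x - V *v x) \<le> sqrt (2 - 2 * Re (f k z))) sequentially"
    proof (rule always_eventually, rule allI)
      fix k
      let ?a = "T k z *v x" and ?b = "V *v x"
      have "(norm (?a - ?b))\<^sup>2 = (norm ?a)\<^sup>2 + (norm ?b)\<^sup>2 - 2 * (?a \<bullet> ?b)"
        by (simp add: power2_norm_eq_inner inner_diff_left inner_diff_right inner_commute)
      also have "\<dots> \<le> 1 + 1 - 2 * (?a \<bullet> ?b)"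
        using contractionD[OF con[OF z], of k x] x by (simp add: power_le_one)
      finally show "norm (?a - ?b) \<le> sqrt (2 - 2 * Re (f k z))"
        by (intro real_le_rsqrt) (simp add: f_def Re_cinner)
    qed
  qed
  then show "(\<lambda>k. T k z *v axis j 1) \<longlonglongrightarrow> V *v axis j 1"
    unfolding x_def[symmetric] by (simp add: LIM_zero_iff)
qed

section \<open>Partial products and the Blaschke condition\<close>

lemma contraction_left_partial_product:
  "(\<And>k. k < N \<Longrightarrow> contraction (B k)) \<Longrightarrow> contraction (left_partial_product B N)"
  by (induction N) (simp_all add: contraction_mat_1 contraction_mult)

lemma det_left_partial_product: "det (left_partial_product B N) = (\<Prod>k<N. det (B k))"
  by (induction N) (simp_all add: det_mul)

text \<open>Since \<beta> \<le> exp (- (1 - \<beta>)), a lower bound \<delta> for the products gives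
  the upper bound - ln \<delta> for the sums.\<close>

lemma summable_one_minus_of_prod_ge:
  fixes \<beta> :: "nat \<Rightarrow> real"
  assumes "\<And>k. 0 \<le> \<beta> k" "\<And>k. \<beta> k \<le> 1" "0 < \<delta>" "\<And>N. \<delta> \<le> (\<Prod>k<N. \<beta> k)"
  shows "summable (\<lambda>k. 1 - \<beta> k)"
proof (rule summableI_nonneg_bounded)
  fix N
  have "\<delta> \<le> (\<Prod>k<N. \<beta> k)" by fact
  also have "\<dots> \<le> (\<Prod>k<N. exp (- (1 - \<beta> k)))"
  proof (intro prod_mono conjI)
    show "\<beta> k \<le> exp (- (1 - \<beta> k))" for k
      using exp_ge_add_one_self[of "\<beta> k - 1"] by simp
  qed (use assms in auto)
  also have "\<dots> = exp (- (\<Sum>k<N. 1 - \<beta> k))"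
    by (simp add: exp_sum sum_negf[symmetric])
  finally have "ln \<delta> \<le> ln (exp (- (\<Sum>k<N. 1 - \<beta> k)))"
    using assms(3) by (intro ln_mono) auto
  then show "(\<Sum>k<N. 1 - \<beta> k) \<le> - ln \<delta>" by simp
qed (use assms in auto)

text \<open>New factors enter on the right, so an increment is the contraction \<open>W N\<close>
  applied to a vector of size |b - 1|, and these sizes are summable.\<close>

lemma left_partial_product_vector_convergent:
  fixes P :: "nat \<Rightarrow> complex^'n^'n"
  assumes v: "\<And>k. norm (v k) = 1" and a: "\<And>k. norm (a k) < 1"
    and s: "summable (\<lambda>k. 1 - norm (a k))" and z: "norm z < 1"
  defines "W \<equiv> left_partial_product (\<lambda>k. bp_factor (a k) (rank_one_projection (v k :: complex^'n)) z)"
  shows "convergent (\<lambda>N. W N *v y)"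
proof -
  have W: "contraction (W N)" for N
    unfolding W_def by (intro contraction_left_partial_product contraction_bp_factor v a z)
  have le: "norm (W (Suc N) *v y - W N *v y) \<le> (1 - norm (a N)) * (2 / (1 - norm z) * norm y)" for N
  proof -
    let ?c = "blaschke_factor (a N) z - 1"
    have "W (Suc N) *v y - W N *v y = W N *v (?c *s (cinner y (v N) *s v N))"
      by (simp add: W_def matrix_vector_mul_assoc[symmetric] bp_factor_vector matrix_vector_right_distrib)
    also have "norm \<dots> \<le> norm (?c *s (cinner y (v N) *s v N))"
      by (rule contractionD[OF W])
    also have "\<dots> = norm ?c * norm (cinner y (v N))"
      by (simp only: norm_vector_scale v mult_1_right)
    also have "\<dots> \<le> ((1 - norm (a N)) * (2 / (1 - norm z))) * norm y"
      using norm_blaschke_factor_minus_1_le[OF a z] norm_cinner_le[of y "v N"] v a[of N] z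
      by (intro mult_mono) auto
    finally show ?thesis by (simp only: mult.assoc)
  qed
  have "summable (\<lambda>N. W (Suc N) *v y - W N *v y)"
    by (rule summable_comparison_test'[OF summable_mult2[OF s]]) (rule le)
  then have "convergent (\<lambda>N. \<Sum>k<N. W (Suc k) *v y - W k *v y)"
    by (simp add: summable_iff_convergent)
  then have "convergent (\<lambda>N. (W N *v y - W 0 *v y) + W 0 *v y)"
    by (intro convergent_add convergent_const) (simp only: sum_lessThan_telescope[of "\<lambda>k. W k *v y"])
  then show ?thesis by simp
qed

text \<open>Taking zeros in order of modulus guarantees that the current remainder is zero-free on
  the disc of radius \<open>norm a\<close>; under the Blaschke condition these radii tend to
  1.\<close>

lemma minimal_zero_exists:
  fixes f :: "complex \<Rightarrow> complex"
  assumes f: "f holomorphic_on ball 0 1" and z: "norm z < 1" "f z = 0"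
  obtains a where "norm a < 1" "f a = 0" "\<And>w. norm w < 1 \<Longrightarrow> f w = 0 \<Longrightarrow> norm a \<le> norm w"
proof -
  let ?S = "{w \<in> cball 0 (norm z). f w = 0}"
  have "continuous_on (cball 0 (norm z)) f"
    using z by (intro holomorphic_on_imp_continuous_on holomorphic_on_subset[OF f]) auto
  then have "closed ?S"
    by (intro continuous_closed_preimage_constant) auto
  moreover have "bounded ?S"
    by (rule bounded_subset[OF bounded_cball[of 0 "norm z"]]) auto
  ultimately have "compact ?S"
    by (simp only: compact_eq_bounded_closed)
  moreover have "z \<in> ?S" using z by simp
  ultimately obtain a where a: "a \<in> ?S" "\<And>w. w \<in> ?S \<Longrightarrow> norm a \<le> norm w"
    using continuous_attains_inf[of ?S norm] continuous_on_norm_id by blast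
  show ?thesis
  proof
    show "norm a < 1" "f a = 0" using a(1) z by auto
    show "norm a \<le> norm w" if "norm w < 1" "f w = 0" for w
      using a(1) a(2)[of w] that by (cases "norm w \<le> norm z") auto
  qed
qed

definition bp_splitting ::
    "(complex \<Rightarrow> complex^'n^'n) \<Rightarrow> complex \<Rightarrow> complex^'n \<Rightarrow> (complex \<Rightarrow> complex^'n^'n) \<Rightarrow> bool" where
  "bp_splitting T a v T' \<longleftrightarrow> norm a < 1 \<and> det (T a) = 0 \<and> norm v = 1 \<and>
     (\<forall>z. norm z < 1 \<longrightarrow> det (T z) = 0 \<longrightarrow> norm a \<le> norm z) \<and>
     (\<forall>z. norm z < 1 \<longrightarrow> T z = bp_factor a (rank_one_projection v) z ** T' z)"

definition holomorphic_contraction :: "(complex \<Rightarrow> complex^'n^'n) \<Rightarrow> bool" where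
  "holomorphic_contraction T \<longleftrightarrow> matrix_holomorphic T \<and> (\<forall>z. norm z < 1 \<longrightarrow> contraction (T z))"

lemma bp_splitting_exists:
  assumes T: "holomorphic_contraction T" and z: "norm z < 1" "det (T z) = 0"
  shows "\<exists>a v T'. bp_splitting T a v T' \<and> holomorphic_contraction T'"
proof -
  obtain a where a: "norm a < 1" "det (T a) = 0"
      "\<And>w. norm w < 1 \<Longrightarrow> det (T w) = 0 \<Longrightarrow> norm a \<le> norm w"
    using minimal_zero_exists[OF matrix_holomorphic_det[of T] z] T
    unfolding holomorphic_contraction_def by metis
  obtain v T' where "norm v = 1" "matrix_holomorphic T'" "\<And>z. norm z < 1 \<Longrightarrow> contraction (T' z)"
      "\<And>z. norm z < 1 \<Longrightarrow> T z = bp_factor a (rank_one_projection v) z ** T' z"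
    using split_off_bp_factor[of T, OF _ _ a(1,2)] T unfolding holomorphic_contraction_def by metis
  then show ?thesis
    using a unfolding bp_splitting_def holomorphic_contraction_def by blast
qed

text \<open>Zeros of minimal modulus are split off one after another. The hypothesis \<open>large\<close> says that
  \<open>det \<Theta>\<close> has no singular inner factor: it forces the remaining factors to have determinants
  tending to modulus 1 at 0, so they tend to a unitary constant.\<close>
lemma left_blaschke_potapovI:
  fixes \<Theta> :: "complex \<Rightarrow> complex^'n^'n"
  assumes \<Theta>: "holomorphic_contraction \<Theta>" and nz: "norm z0 < 1" "det (\<Theta> z0) \<noteq> 0"
    and large: "\<And>\<epsilon>. 0 < \<epsilon> \<Longrightarrow> \<exists>r. 0 < r \<and> r < 1 \<and> (\<forall>g. g holomorphic_on ball 0 1 \<longrightarrow>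
      (\<forall>z. norm z < 1 \<longrightarrow> norm (det (\<Theta> z)) \<le> norm (g z) \<and> norm (g z) \<le> 1) \<longrightarrow>
      (\<forall>z. norm z < r \<longrightarrow> g z \<noteq> 0) \<longrightarrow> 1 - \<epsilon> \<le> norm (g 0))"
  shows "left_blaschke_potapov \<Theta>"
proof -
  let ?zs = "\<lambda>T. \<exists>z. norm z < 1 \<and> det (T z) = 0"
  have "\<exists>T. \<forall>n. holomorphic_contraction (T n) \<and> (n = 0 \<longrightarrow> T n = \<Theta>) \<and>
      (?zs (T n) \<longrightarrow> (\<exists>a v. bp_splitting (T n) a v (T (Suc n))))"
  proof -
    have "\<exists>T. \<forall>n. (holomorphic_contraction (T n) \<and> (n = 0 \<longrightarrow> T n = \<Theta>)) \<and>
      (?zs (T n) \<longrightarrow> (\<exists>a v. bp_splitting (T n) a v (T (Suc n))))"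
    proof (rule dependent_nat_choice)
      show "\<exists>x. holomorphic_contraction x \<and> (0 = 0 \<longrightarrow> x = \<Theta>)" for n :: nat
        using \<Theta> by blast
      show "\<exists>y. (holomorphic_contraction y \<and> (Suc n = 0 \<longrightarrow> y = \<Theta>)) \<and>
          (?zs x \<longrightarrow> (\<exists>a v. bp_splitting x a v y))"
        if "holomorphic_contraction x \<and> (n = 0 \<longrightarrow> x = \<Theta>)" for n x
        using bp_splitting_exists[of x] that by (cases "?zs x") blast+
    qed
    then show ?thesis by blast
  qed
  then obtain T where T: "\<And>n. holomorphic_contraction (T n)" and T0: "T 0 = \<Theta>"
      and "\<forall>n. \<exists>a v. ?zs (T n) \<longrightarrow> bp_splitting (T n) a v (T (Suc n))"
    by metis
  then obtain a' v' where spl: "\<And>n. ?zs (T n) \<Longrightarrow> bp_splitting (T n) (a' n) (v' n) (T (Suc n))"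
    by metis
  \<comment> \<open>\<open>e\<close> and 0 are default values for the indices after the zeros are
    exhausted: \<open>left_blaschke_potapov\<close> asks for admissible points and projections at
    every index, even for a finite product.\<close>
  define e :: "complex^'n" where "e = axis undefined 1"
  define a where "a n = (if ?zs (T n) then a' n else 0)" for n
  define v where "v n = (if ?zs (T n) then v' n else e)" for n
  have v: "norm (v n) = 1" and a: "norm (a n) < 1" for n
    using spl[of n] by (auto simp: a_def v_def e_def norm_axis_1 bp_splitting_def)
  have hol: "matrix_holomorphic (T n)" and con: "norm z < 1 \<Longrightarrow> contraction (T n z)" for n z
    using T[of n] by (auto simp: holomorphic_contraction_def)
  define P where "P n = rank_one_projection (v n)" for n
  define W where "W N z = left_partial_product (\<lambda>k. bp_factor (a k) (P k) z) N" for N z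
  have P: "orthogonal_projection (P k)" "P k \<noteq> 0" "trace (P k) = 1" for k
    unfolding P_def by (rule rank_one_projection v)+
  have W: "contraction (W N z)" if "norm z < 1" for N z
    unfolding W_def P_def by (intro contraction_left_partial_product contraction_bp_factor v a that)
  have fac: "\<Theta> z = W N z ** T N z" if "\<And>k. k < N \<Longrightarrow> ?zs (T k)" "norm z < 1" for N z
    using that(1)
  proof (induction N)
    case 0
    then show ?case by (simp add: W_def T0)
  next
    case (Suc N)
    have "T N z = bp_factor (a N) (P N) z ** T (Suc N) z"
      using spl[of N] Suc.prems[of N] that(2) by (simp add: bp_splitting_def a_def v_def P_def)
    with Suc show ?case by (simp add: W_def matrix_mul_assoc)
  qed
  have det_le: "norm (det (\<Theta> z)) \<le> norm (det (T N z))"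
    if "\<And>k. k < N \<Longrightarrow> ?zs (T k)" "norm z < 1" for N z
    using norm_det_contraction_le_1[OF W[OF that(2), of N]]
    by (simp add: fac[OF that] det_mul norm_mult mult_left_le_one_le)
  have det_T_le: "norm (det (T N z)) \<le> 1" if "norm z < 1" for N z
    by (rule norm_det_contraction_le_1[OF con[OF that]])
  show ?thesis
  proof (cases "\<exists>N. \<not> ?zs (T N)")
    case True
    define N where "N = (LEAST N. \<not> ?zs (T N))"
    have zs: "?zs (T k)" if "k < N" for k
      using not_less_Least[of k "\<lambda>N. \<not> ?zs (T N)"] that by (auto simp: N_def)
    have nzs: "\<not> ?zs (T N)"
      unfolding N_def by (rule LeastI_ex[OF True])
    \<comment> \<open>The last remainder is zero-free on the whole disc, hence admissible as
      \<open>g\<close> for every \<epsilon>.\<close>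
    have "1 - \<epsilon> \<le> norm (det (T N 0))" if \<epsilon>: "0 < \<epsilon>" for \<epsilon>
    proof -
      obtain r where "r < 1" and lg: "\<And>g. g holomorphic_on ball 0 1 \<Longrightarrow>
          (\<And>z. norm z < 1 \<Longrightarrow> norm (det (\<Theta> z)) \<le> norm (g z) \<and> norm (g z) \<le> 1) \<Longrightarrow>
          (\<And>z. norm z < r \<Longrightarrow> g z \<noteq> 0) \<Longrightarrow> 1 - \<epsilon> \<le> norm (g 0)"
        using large[OF \<epsilon>] by blast
      show ?thesis
      proof (rule lg[OF matrix_holomorphic_det[OF hol[of N]]])
        show "det (T N z) \<noteq> 0" if "norm z < r" for z
          using nzs that \<open>r < 1\<close> by (meson less_trans)
      qed (use det_le[OF zs] det_T_le in auto)
    qed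
    then have "1 \<le> norm (det (T N 0))"
      by (metis diff_le_eq field_le_epsilon)
    then have d1: "norm (det (T N 0)) = 1"
      using det_T_le[of 0 N] by simp
    note u = contraction_det_unimodular_unitary[OF con[of 0 N] d1]
    have const: "T N z = T N 0" if z: "norm z < 1" for z
    proof -
      \<comment> \<open>Applied to a constant sequence, the convergence result becomes rigidity: the
        remainder is itself a constant function.\<close>
      have "(\<lambda>k :: nat. T N z) \<longlonglongrightarrow> T N 0"
        by (rule contractions_tendsto_constant[OF hol con _ _ z]) (use u in auto)
      then show ?thesis by (simp add: LIMSEQ_const_iff)
    qed
    have "\<Theta> z = left_partial_product (\<lambda>k. bp_factor (a k) (P k) z) N ** T N 0" if "z \<in> ball 0 1" for z
      using fac[OF zs, of N z] const[of z] that unfolding W_def by (simp only: mem_ball_0)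
    then show ?thesis
      unfolding left_blaschke_potapov_def using u(1) P a
      by (intro exI[of _ "T N 0"] exI[of _ a] exI[of _ P]) auto
  next
    case False
    then have zs: "?zs (T k)" for k by blast
    \<comment> \<open>The Blaschke condition is read off at \<open>z0\<close>, since
      \<open>det (\<Theta> 0)\<close> may vanish.\<close>
    let ?\<beta> = "\<lambda>k. norm (blaschke_factor (a k) z0)"
    have "summable (\<lambda>k. 1 - ?\<beta> k)"
    proof (rule summable_one_minus_of_prod_ge)
      show "?\<beta> k \<le> 1" for k
        using norm_blaschke_factor_less_1[OF a nz(1)] by (simp add: less_imp_le)
      show "norm (det (\<Theta> z0)) \<le> (\<Prod>k<N. ?\<beta> k)" for N
      proof -
        have "norm (det (\<Theta> z0)) \<le> norm (det (W N z0))"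
          using det_T_le[OF nz(1), of N]
          by (simp add: fac[OF zs nz(1), of N] det_mul norm_mult mult_left_le)
        also have "\<dots> = (\<Prod>k<N. norm (det (bp_factor (a k) (P k) z0)))"
          by (simp add: W_def det_left_partial_product prod_norm)
        also have "\<dots> \<le> (\<Prod>k<N. ?\<beta> k)"
          unfolding P_def by (intro prod_mono conjI norm_det_bp_factor_le v a nz(1)) auto
        finally show ?thesis .
      qed
    qed (use nz in auto)
    note sb = this
    define c where "c = (1 - (norm z0)\<^sup>2) / 8"
    have c: "c > 0" using nz(1) by (simp add: c_def power_less_one_iff)
    have "norm ((1 - norm (a k)) * c) \<le> 1 - ?\<beta> k" for k
    proof -
      have "norm ((1 - norm (a k)) * c) = (1 - norm (a k)) * c"
        using a[of k] c by simp
      also have "\<dots> \<le> 1 - ?\<beta> k"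
        unfolding c_def by (rule one_minus_norm_blaschke_factor_ge[OF a nz(1)])
      finally show ?thesis .
    qed
    then have "summable (\<lambda>k. (1 - norm (a k)) * c)"
      by (rule summable_comparison_test'[OF sb])
    then have s: "summable (\<lambda>k. 1 - norm (a k))"
      using summable_mult2[of "\<lambda>k. (1 - norm (a k)) * c" "inverse c"] c by (simp add: mult.assoc)
    then have a_lim: "(\<lambda>k. norm (a k)) \<longlonglongrightarrow> 1"
      using tendsto_diff[OF tendsto_const[of 1] summable_LIMSEQ_zero[OF s]] by simp
    \<comment> \<open>For large \<open>N\<close> the minimal zero of the remainder lies beyond the
      radius \<open>r\<close> supplied by \<open>large\<close>, so its determinant is admissible as
      \<open>g\<close>.\<close>
    have det_lim: "(\<lambda>N. norm (det (T N 0))) \<longlonglongrightarrow> 1"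
    proof (rule order_tendstoI)
      fix y :: real assume "y < 1"
      then have "0 < (1 - y) / 2" by simp
      from large[OF this] obtain r where r: "0 < r" "r < 1"
        and lg: "\<And>g. g holomorphic_on ball 0 1 \<Longrightarrow>
          (\<And>z. norm z < 1 \<Longrightarrow> norm (det (\<Theta> z)) \<le> norm (g z) \<and> norm (g z) \<le> 1) \<Longrightarrow>
          (\<And>z. norm z < r \<Longrightarrow> g z \<noteq> 0) \<Longrightarrow> 1 - (1 - y) / 2 \<le> norm (g 0)"
        by blast
      from order_tendstoD(1)[OF a_lim r(2)]
      show "eventually (\<lambda>N. y < norm (det (T N 0))) sequentially"
      proof eventually_elim
        case (elim N)
        have "1 - (1 - y) / 2 \<le> norm (det (T N 0))"
        proof (rule lg[OF matrix_holomorphic_det[OF hol[of N]]])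
          show "det (T N z) \<noteq> 0" if "norm z < r" for z
          proof
            assume "det (T N z) = 0"
            moreover have "norm z < 1" using that r by simp
            moreover have "a N = a' N" using zs[of N] by (simp only: a_def if_True)
            ultimately have "norm (a N) \<le> norm z"
              using spl[OF zs[of N]] by (simp add: bp_splitting_def)
            then show False using elim that by simp
          qed
        qed (use det_le[OF zs] det_T_le in auto)
        then show ?case using \<open>y < 1\<close> by (simp add: field_simps)
      qed
    next
      fix y :: real assume "1 < y"
      then show "eventually (\<lambda>N. norm (det (T N 0)) < y) sequentially"
        using det_T_le[of 0] by (intro always_eventually) (auto intro: le_less_trans)
    qed
    \<comment> \<open>Compactness yields the constant \<open>V\<close> only along a subsequence. The
      partial products converge along the full sequence by the Blaschke condition, so the
      subsequence identifies their limit.\<close>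
    have "bounded (range (\<lambda>N. T N 0))"
      by (rule bounded_subset[OF bounded_contractions]) (auto intro: con)
    then obtain V \<sigma> where \<sigma>: "strict_mono \<sigma>" and V: "((\<lambda>N. T N 0) \<circ> \<sigma>) \<longlonglongrightarrow> V"
      using bounded_imp_convergent_subsequence by blast
    have "(\<lambda>N. norm (det (T (\<sigma> N) 0))) \<longlonglongrightarrow> norm (det V)"
      using V by (intro tendsto_norm tendsto_det) (simp add: o_def)
    then have "norm (det V) = 1"
      using LIMSEQ_subseq_LIMSEQ[OF det_lim \<sigma>] LIMSEQ_unique by (fastforce simp: o_def)
    moreover have "contraction V"
      using contraction_limit[OF V] con[of 0] by simp
    ultimately have u: "unitary_matrix V" "\<And>x. norm (V *v x) = norm x"
      by (simp_all add: contraction_det_unimodular_unitary)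
    have "(\<lambda>N. W N z ** V) \<longlonglongrightarrow> \<Theta> z" if z: "norm z < 1" for z
    proof (rule tendsto_matrixI)
      fix j
      let ?y = "axis j 1 :: complex^'n"
      have conv: "convergent (\<lambda>N. W N z *v (V *v ?y))"
        unfolding W_def P_def by (rule left_partial_product_vector_convergent[OF v a s z])
      have "(\<lambda>k. T (\<sigma> k) z) \<longlonglongrightarrow> V"
        by (rule contractions_tendsto_constant[OF hol con _ u(2) z]) (use V in \<open>auto simp: o_def\<close>)
      then have "(\<lambda>k. V *v ?y - T (\<sigma> k) z *v ?y) \<longlonglongrightarrow> V *v ?y - V *v ?y"
        by (intro tendsto_intros tendsto_matrix_vector_mult)
      then have T_lim: "(\<lambda>k. norm (V *v ?y - T (\<sigma> k) z *v ?y)) \<longlonglongrightarrow> 0"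
        by (simp add: tendsto_norm_zero_iff)
      have "(\<lambda>k. W (\<sigma> k) z *v (V *v ?y) - \<Theta> z *v ?y) \<longlonglongrightarrow> 0"
      proof (rule Lim_null_comparison[OF always_eventually T_lim], rule allI)
        fix k
        have "W (\<sigma> k) z *v (V *v ?y) - \<Theta> z *v ?y = W (\<sigma> k) z *v (V *v ?y - T (\<sigma> k) z *v ?y)"
          by (simp add: fac[OF zs z, of "\<sigma> k"] matrix_vector_mul_assoc matrix_vector_mult_diff_distrib)
        then show "norm (W (\<sigma> k) z *v (V *v ?y) - \<Theta> z *v ?y) \<le> norm (V *v ?y - T (\<sigma> k) z *v ?y)"
          using contractionD[OF W[OF z]] by simp
      qed
      then have "(\<lambda>k. W (\<sigma> k) z *v (V *v ?y)) \<longlonglongrightarrow> \<Theta> z *v ?y"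
        by (simp add: LIM_zero_iff)
      moreover from conv obtain l where l: "(\<lambda>N. W N z *v (V *v ?y)) \<longlonglongrightarrow> l"
        by (auto simp: convergent_def)
      ultimately have "l = \<Theta> z *v ?y"
        using LIMSEQ_subseq_LIMSEQ[OF l \<sigma>] LIMSEQ_unique by (fastforce simp: o_def)
      with l show "(\<lambda>N. (W N z ** V) *v ?y) \<longlonglongrightarrow> \<Theta> z *v ?y"
        by (simp add: matrix_vector_mul_assoc)
    qed
    moreover have "summable (\<lambda>k. (1 - norm (a k)) * Re (trace (P k)))"
      using s P(3) by simp
    ultimately show ?thesis
      unfolding left_blaschke_potapov_def using u(1) P a
      by (intro exI[of _ V] exI[of _ a] exI[of _ P]) (auto simp: W_def)
  qed
qed

section \<open>Normalized Lebesgue measure on the circle\<close>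

lemma sets_circle_measure: "sets circle_measure = sets (restrict_space borel (sphere 0 1))"
  by (simp add: circle_measure_def)

lemma space_circle_measure: "space circle_measure = sphere 0 1"
  by (simp add: circle_measure_def space_restrict_space)

lemma measurable_circle_measure_iff:
  "f \<in> borel_measurable circle_measure \<longleftrightarrow> f \<in> borel_measurable (restrict_space borel (sphere 0 1))"
  by (rule arg_cong[where f = "\<lambda>S. f \<in> S"]) (rule measurable_cong_sets[OF sets_circle_measure refl])

lemma borel_measurable_circle_measure:
  fixes f :: "complex \<Rightarrow> 'b::topological_space"
  assumes "continuous_on (sphere 0 1) f"
  shows "f \<in> borel_measurable circle_measure"
  unfolding measurable_circle_measure_iff by (rule borel_measurable_continuous_on_restrict[OF assms])

lemma emeasure_interval_2pi: "emeasure lborel {0..<2 * pi} = ennreal (2 * pi)"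
  by simp

lemma cis_measurable:
  "cis \<in> measurable (uniform_measure lborel {0..<2 * pi}) (restrict_space borel (sphere 0 1))"
proof (rule measurable_restrict_space2)
  have "continuous_on UNIV cis" by (intro continuous_intros)
  then have "cis \<in> borel_measurable borel" by (rule borel_measurable_continuous_onI)
  then show "cis \<in> borel_measurable (uniform_measure lborel {0..<2 * pi})"
    by (simp add: measurable_def)
qed (auto simp: norm_cis)

lemma emeasure_circle_measure_space: "emeasure circle_measure (sphere 0 1) = 1"
proof -
  have "emeasure circle_measure (sphere 0 1) =
      emeasure (uniform_measure lborel {0..<2 * pi}) (cis -` sphere 0 1 \<inter> UNIV)"
    unfolding circle_measure_def
    by (subst emeasure_distr[OF cis_measurable]) (auto simp: space_restrict_space sets_restrict_space)
  also have "cis -` sphere 0 1 \<inter> UNIV = UNIV" by (auto simp: norm_cis)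
  also have "emeasure (uniform_measure lborel {0..<2 * pi}) UNIV = 1"
    by (subst emeasure_uniform_measure) (auto simp: divide_eq_1_ennreal)
  finally show ?thesis .
qed

interpretation circle: finite_measure circle_measure
  by (rule finite_measureI) (simp add: space_circle_measure emeasure_circle_measure_space)

lemma measure_circle_measure_space: "measure circle_measure (sphere 0 1) = 1"
  by (simp add: measure_def emeasure_circle_measure_space)

lemma integrable_circle_measure:
  fixes f :: "complex \<Rightarrow> 'b::{banach, second_countable_topology}"
  assumes "continuous_on (sphere 0 1) f"
  shows "integrable circle_measure f"
proof -
  have "compact (f ` sphere 0 1)" by (rule compact_continuous_image[OF assms]) simp
  then obtain B where "\<And>t. t \<in> sphere 0 1 \<Longrightarrow> norm (f t) \<le> B"
    using compact_imp_bounded[of "f ` sphere 0 1"] unfolding bounded_iff by blast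
  then show ?thesis
    by (intro circle.integrable_const_bound[of _ B] AE_I2 borel_measurable_circle_measure assms)
      (simp add: space_circle_measure)
qed

text \<open>The mean value property: Cauchy's integral formula after parametrizing the circle by
  \<open>cis\<close>.\<close>

lemma integral_circle_measure_holomorphic:
  assumes f: "f holomorphic_on ball 0 R" and r: "0 \<le> r" "r < R"
  shows "(LINT t|circle_measure. f (of_real r * t)) = (f 0 :: complex)"
proof (cases "r = 0")
  case True
  then show ?thesis
    by (simp add: space_circle_measure measure_circle_measure_space)
next
  case False
  with r have r0: "r > 0" by simp
  have cont: "continuous_on {0..2 * pi} (\<lambda>x. f (of_real r * cis x))"
    by (rule continuous_on_compose2[OF holomorphic_on_imp_continuous_on[OF f]])
      (use r in \<open>auto intro!: continuous_intros simp: norm_mult norm_cis\<close>)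
  have sphere_cont: "continuous_on (sphere 0 1) (\<lambda>t. f (of_real r * t))"
    by (rule continuous_on_compose2[OF holomorphic_on_imp_continuous_on[OF f]])
      (use r in \<open>auto intro!: continuous_intros simp: norm_mult\<close>)
  have "((\<lambda>u. f u / (u - 0)) has_contour_integral (2 * of_real pi * \<i> * f 0)) (circlepath 0 r)"
    by (rule Cauchy_integral_circlepath_simple) (use r r0 in \<open>auto intro: holomorphic_on_subset[OF f]\<close>)
  then have "((\<lambda>x. \<i> * f (of_real r * cis x)) has_integral (2 * of_real pi * \<i> * f 0)) {0..2 * pi}"
    unfolding circlepath_def using r0
    by (subst (asm) has_contour_integral_part_circlepath_iff) (simp_all add: mult.commute)
  from has_integral_mult_right[OF this, of "- \<i>"]
  have hk: "((\<lambda>x. f (of_real r * cis x)) has_integral (2 * of_real pi * f 0)) {0..2 * pi}"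
    by (simp add: mult.assoc[symmetric]) (simp add: mult_ac)
  have "(LINT t|circle_measure. f (of_real r * t)) =
      (LINT x|uniform_measure lborel {0..<2 * pi}. f (of_real r * cis x))"
    unfolding circle_measure_def
    by (rule integral_distr[OF cis_measurable])
      (use sphere_cont in \<open>rule borel_measurable_continuous_on_restrict\<close>)
  also have "\<dots> = (LINT x|density lborel (\<lambda>x. ennreal (indicator {0..<2 * pi} x / (2 * pi))). f (of_real r * cis x))"
    unfolding uniform_measure_def emeasure_interval_2pi
    by (rule arg_cong[where f = "\<lambda>M. lebesgue_integral (density lborel M) _"])
      (auto simp: fun_eq_iff indicator_def divide_ennreal[symmetric] ennreal_1[symmetric] simp del: ennreal_1)
  also have "\<dots> = (LINT x|lborel. (indicator {0..<2 * pi} x / (2 * pi)) *\<^sub>R f (of_real r * cis x))"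
  proof (rule integral_density)
    have "f \<circ> (\<lambda>x. of_real r * cis x) \<in> borel_measurable borel"
    proof (rule borel_measurable_continuous_onI)
      show "continuous_on UNIV (f \<circ> (\<lambda>x. of_real r * cis x))"
        unfolding o_def
        by (rule continuous_on_compose2[OF holomorphic_on_imp_continuous_on[OF f]])
          (use r in \<open>auto intro!: continuous_intros simp: norm_mult norm_cis\<close>)
    qed
    then show "(\<lambda>x. f (of_real r * cis x)) \<in> borel_measurable lborel" by (simp add: o_def)
  qed auto
  also have "\<dots> = (LINT x|lborel. (1 / (2 * pi)) *\<^sub>R (indicator {0..2 * pi} x *\<^sub>R f (of_real r * cis x)))"
  proof (rule integral_cong_AE)
    show "AE x in lborel. (indicator {0..<2 * pi} x / (2 * pi)) *\<^sub>R f (of_real r * cis x) =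
        (1 / (2 * pi)) *\<^sub>R (indicator {0..2 * pi} x *\<^sub>R f (of_real r * cis x))"
      using AE_lborel_singleton[of "2 * pi"] by eventually_elim (auto simp: indicator_def)
  next
    have m: "(\<lambda>x. f (of_real r * cis x)) \<in> borel_measurable borel"
      by (rule borel_measurable_continuous_onI)
        (rule continuous_on_compose2[OF holomorphic_on_imp_continuous_on[OF f]],
          use r in \<open>auto intro!: continuous_intros simp: norm_mult norm_cis\<close>)
    show "(\<lambda>x. (indicator {0..<2 * pi} x / (2 * pi)) *\<^sub>R f (of_real r * cis x)) \<in> borel_measurable lborel"
      "(\<lambda>x. (1 / (2 * pi)) *\<^sub>R (indicator {0..2 * pi} x *\<^sub>R f (of_real r * cis x))) \<in> borel_measurable lborel"
      using m by measurable
  qed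
  also have "\<dots> = (1 / (2 * pi)) *\<^sub>R (LINT x:{0..2 * pi}|lborel. f (of_real r * cis x))"
    unfolding set_lebesgue_integral_def by (rule integral_scaleR_right)
  also have "(LINT x:{0..2 * pi}|lborel. f (of_real r * cis x)) = 2 * of_real pi * f 0"
    using set_borel_integral_eq_integral(2)[OF borel_integrable_atLeastAtMost'[OF cont]] hk
    by (simp add: integral_unique)
  finally show ?thesis by (simp add: scaleR_conv_of_real)
qed

text \<open>Jensen's formula in the absence of zeros: a holomorphic logarithm exists, and ln |g| is
  its real part.\<close>

lemma integral_circle_measure_ln_norm:
  fixes g :: "complex \<Rightarrow> complex"
  assumes g: "g holomorphic_on ball 0 R" and nz: "\<And>z. norm z < R \<Longrightarrow> g z \<noteq> 0" and r: "0 \<le> r" "r < R"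
  shows "integrable circle_measure (\<lambda>t. ln (norm (g (of_real r * t))))"
    and "(LINT t|circle_measure. ln (norm (g (of_real r * t)))) = ln (norm (g 0))"
proof -
  obtain h where h: "h holomorphic_on ball 0 R" "\<And>x. x \<in> ball 0 R \<Longrightarrow> exp (h x) = g x"
    using holomorphic_logarithm_exists[of "ball 0 R" g 0] g nz r by auto
  have ln: "ln (norm (g z)) = Re (h z)" if "norm z < R" for z
    using h(2)[of z] that by (metis ln_exp mem_ball_0 norm_exp_eq_Re)
  have eq: "ln (norm (g (of_real r * t))) = Re (h (of_real r * t))" if "t \<in> space circle_measure" for t
    using that r by (intro ln) (simp add: space_circle_measure norm_mult)
  have int: "integrable circle_measure (\<lambda>t. h (of_real r * t))"
    by (intro integrable_circle_measure continuous_on_compose2[OF holomorphic_on_imp_continuous_on[OF h(1)]])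
      (use r in \<open>auto intro!: continuous_intros simp: norm_mult\<close>)
  have "integrable circle_measure (\<lambda>t. Re (h (of_real r * t)))"
    using int by (rule integrable_Re)
  then show "integrable circle_measure (\<lambda>t. ln (norm (g (of_real r * t))))"
    by (subst Bochner_Integration.integrable_cong[OF refl eq]) 
  have "(LINT t|circle_measure. ln (norm (g (of_real r * t)))) = (LINT t|circle_measure. Re (h (of_real r * t)))"
    by (rule Bochner_Integration.integral_cong[OF refl eq])
  also have "\<dots> = Re (LINT t|circle_measure. h (of_real r * t))"
    using int by (rule integral_Re)
  also have "\<dots> = ln (norm (g 0))"
    using ln[of 0] r by (simp add: integral_circle_measure_holomorphic[OF h(1) r])
  finally show "(LINT t|circle_measure. ln (norm (g (of_real r * t)))) = ln (norm (g 0))" .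
qed

section \<open>The Poisson kernel\<close>

definition poisson_kernel :: "real \<Rightarrow> complex \<Rightarrow> complex \<Rightarrow> real" where
  "poisson_kernel r s t = (1 - r\<^sup>2) / (norm (s - of_real r * t))\<^sup>2"

lemma poisson_kernel_nonneg: "0 \<le> r \<Longrightarrow> r < 1 \<Longrightarrow> 0 \<le> poisson_kernel r s t"
  by (simp add: poisson_kernel_def power_le_one)

text \<open>Symmetry gives the kernel total mass 1 in either variable, which is needed once Fubini
  has exchanged their roles.\<close>

lemma poisson_kernel_commute:
  assumes "norm s = 1" "norm t = 1"
  shows "poisson_kernel r s t = poisson_kernel r t s"
proof -
  have "(Re s)\<^sup>2 + (Im s)\<^sup>2 = 1" "(Re t)\<^sup>2 + (Im t)\<^sup>2 = 1"
    using assms by (metis cmod_power2 one_power2)+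
  note sq = this
  have "(norm (s - of_real r * t))\<^sup>2 = (Re s)\<^sup>2 + (Im s)\<^sup>2 + r\<^sup>2 * ((Re t)\<^sup>2 + (Im t)\<^sup>2)
      - 2 * r * (Re s * Re t + Im s * Im t)" for s t :: complex
    unfolding cmod_power2 by (simp add: power2_eq_square algebra_simps)
  with sq have "(norm (s - of_real r * t))\<^sup>2 = (norm (t - of_real r * s))\<^sup>2"
    by (simp add: mult.commute)
  then show ?thesis by (simp add: poisson_kernel_def)
qed

lemma Re_herglotz_kernel:
  assumes "norm s = 1" "norm t = 1" "0 \<le> r" "r < 1"
  shows "Re ((s + of_real r * t) / (s - of_real r * t)) = poisson_kernel r s t"
proof -
  let ?z = "of_real r * t"
  have "Re ((s + ?z) / (s - ?z)) = Re ((s + ?z) * cnj (s - ?z)) / (norm (s - ?z))\<^sup>2"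
    by (subst complex_div_cnj)
      (simp only: Re_divide_of_real of_real_power[symmetric])
  also have "Re ((s + ?z) * cnj (s - ?z)) = (norm s)\<^sup>2 - (norm ?z)\<^sup>2"
    unfolding cmod_power2 by (simp add: power2_eq_square algebra_simps)
  also have "\<dots> = 1 - r\<^sup>2"
    using assms by (simp add: norm_mult)
  finally show ?thesis by (simp add: poisson_kernel_def)
qed

lemma continuous_on_poisson_kernel:
  assumes "0 \<le> r" "r < 1"
  shows "continuous_on (sphere 0 1 \<times> sphere 0 1) (\<lambda>p. poisson_kernel r (fst p) (snd p))"
proof -
  have "s \<noteq> of_real r * t" if "norm s = 1" "norm t = 1" for s t :: complex
    using that assms by (auto simp: norm_mult)
  then show ?thesis
    unfolding poisson_kernel_def by (intro continuous_intros) auto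
qed

lemma borel_measurable_circle_pair:
  fixes f :: "complex \<times> complex \<Rightarrow> 'b::topological_space"
  assumes "continuous_on (sphere 0 1 \<times> sphere 0 1) f"
  shows "f \<in> borel_measurable (circle_measure \<Otimes>\<^sub>M circle_measure)"
proof -
  have id: "(\<lambda>t. t) \<in> measurable circle_measure (restrict_space borel (sphere 0 1))"
    by (simp add: measurable_def sets_circle_measure space_circle_measure space_restrict_space)
      (metis sets.Int_space_eq2 sets_circle_measure space_circle_measure)
  have id': "(\<lambda>t. t) \<in> borel_measurable circle_measure"
    by (rule borel_measurable_circle_measure) (rule continuous_on_id)
  have "(\<lambda>p. p) \<in> measurable (circle_measure \<Otimes>\<^sub>M circle_measure) (restrict_space borel (sphere 0 1 \<times> sphere 0 1))"
  proof (rule measurable_restrict_space2)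
    have "(\<lambda>p. (fst p, snd p)) \<in> borel_measurable (circle_measure \<Otimes>\<^sub>M circle_measure)"
      using measurable_compose[OF measurable_fst id'] measurable_compose[OF measurable_snd id']
      by (intro borel_measurable_Pair) 
    then show "(\<lambda>p. p) \<in> borel_measurable (circle_measure \<Otimes>\<^sub>M circle_measure)" by simp
  qed (auto simp: space_pair_measure space_circle_measure)
  from measurable_compose[OF this borel_measurable_continuous_on_restrict[OF assms]] show ?thesis .
qed

text \<open>The kernel is the real part of (s + z) / (s - z), which is holomorphic in the disc with
  value 1 at 0.\<close>

lemma nn_integral_poisson_kernel:
  assumes s: "norm s = 1" and r: "0 \<le> r" "r < 1"
  shows "(\<integral>\<^sup>+t. ennreal (poisson_kernel r s t) \<partial>circle_measure) = 1"
proof -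
  define f where "f z = (s + z) / (s - z)" for z
  have "s \<noteq> z" if "norm z < 1" for z using that s by auto
  then have f: "f holomorphic_on ball 0 1"
    unfolding f_def by (intro holomorphic_intros) auto
  have eq: "Re (f (of_real r * t)) = poisson_kernel r s t" if "t \<in> space circle_measure" for t
    unfolding f_def using that s r by (intro Re_herglotz_kernel) (auto simp: space_circle_measure)
  have int: "integrable circle_measure (\<lambda>t. f (of_real r * t))"
    by (intro integrable_circle_measure continuous_on_compose2[OF holomorphic_on_imp_continuous_on[OF f]])
      (use r in \<open>auto intro!: continuous_intros simp: norm_mult\<close>)
  have "(\<integral>\<^sup>+t. ennreal (poisson_kernel r s t) \<partial>circle_measure) =
      (\<integral>\<^sup>+t. ennreal (Re (f (of_real r * t))) \<partial>circle_measure)"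
    by (rule nn_integral_cong) (simp add: eq)
  also have "\<dots> = ennreal (LINT t|circle_measure. Re (f (of_real r * t)))"
    using r by (intro nn_integral_eq_integral integrable_Re int AE_I2) (simp add: eq poisson_kernel_nonneg)
  also have "(LINT t|circle_measure. Re (f (of_real r * t))) = Re (f 0)"
    using integral_circle_measure_holomorphic[OF f r] int by simp
  also have "Re (f 0) = 1" using s by (auto simp: f_def)
  finally show ?thesis by simp
qed

section \<open>Poisson integrals and outer functions\<close>

interpretation circle_pair: pair_sigma_finite circle_measure circle_measure ..

lemma measurable_poisson_kernel [measurable]:
  assumes "0 \<le> r" "r < 1"
  shows "(\<lambda>p. poisson_kernel r (fst p) (snd p)) \<in> borel_measurable (circle_measure \<Otimes>\<^sub>M circle_measure)"
  by (intro borel_measurable_circle_pair continuous_on_poisson_kernel assms)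

text \<open>Uniform integrability of Poisson integrals: moving the kernel to the indicator of \<open>E\<close> turns it
  into a function with values in \<open>[0, 1]\<close> and mean \<open>m(E)\<close>.\<close>
lemma poisson_integrals_uniformly_integrable:
  assumes g: "integrable circle_measure g" and \<epsilon>: "0 < \<epsilon>"
  obtains \<delta> where "0 < \<delta>" "\<And>r E. 0 \<le> r \<Longrightarrow> r < 1 \<Longrightarrow> E \<in> sets circle_measure \<Longrightarrow>
    measure circle_measure E < \<delta> \<Longrightarrow>
    (\<integral>\<^sup>+t. indicator E t * (\<integral>\<^sup>+s. ennreal (poisson_kernel r s t) * ennreal \<bar>g s\<bar> \<partial>circle_measure)
      \<partial>circle_measure) < ennreal \<epsilon>"
proof -
  have gm [measurable]: "g \<in> borel_measurable circle_measure" using g by auto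
  have "(\<lambda>n :: nat. LINT s|circle_measure. \<bar>g s\<bar> * indicator {s. real n < \<bar>g s\<bar>} s) \<longlonglongrightarrow>
      (LINT s|circle_measure. 0)"
  proof (rule integral_dominated_convergence[where w = "\<lambda>s. \<bar>g s\<bar>"])
    show "AE s in circle_measure. (\<lambda>n. \<bar>g s\<bar> * indicator {s. real n < \<bar>g s\<bar>} s) \<longlonglongrightarrow> 0"
    proof (rule AE_I2, rule tendsto_eventually)
      fix s
      obtain n0 :: nat where "\<bar>g s\<bar> \<le> real n0" using real_arch_simple by blast
      then show "eventually (\<lambda>n. \<bar>g s\<bar> * indicator {s. real n < \<bar>g s\<bar>} s = 0) sequentially"
        by (intro eventually_sequentiallyI[of n0]) (auto simp: indicator_def)
    qed
    show "AE s in circle_measure. norm (\<bar>g s\<bar> * indicator {s. real n < \<bar>g s\<bar>} s) \<le> \<bar>g s\<bar>" for n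
      by (rule AE_I2) (auto simp: indicator_def)
  qed (use g in \<open>auto simp: indicator_def\<close>)
  then have "eventually (\<lambda>n :: nat. (LINT s|circle_measure. \<bar>g s\<bar> * indicator {s. real n < \<bar>g s\<bar>} s) < \<epsilon> / 2) sequentially"
    using \<epsilon> by (intro order_tendstoD(2)) auto
  then obtain n :: nat where n: "(LINT s|circle_measure. \<bar>g s\<bar> * indicator {s. real n < \<bar>g s\<bar>} s) < \<epsilon> / 2"
    by (auto simp: eventually_sequentially)
  \<comment> \<open>|g| is at most \<open>n\<close> + \<phi>, where the tail \<phi> has integral at
    most \<epsilon>/2. The bounded part will be controlled by the measure of \<open>E\<close>, the
    tail by \<open>\<Phi>\<close> \<le> 1.\<close>
  define \<phi> where "\<phi> s = \<bar>g s\<bar> * indicator {s. real n < \<bar>g s\<bar>} s" for s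
  have \<phi>m [measurable]: "\<phi> \<in> borel_measurable circle_measure"
    unfolding \<phi>_def by measurable
  have \<phi>_int: "integrable circle_measure \<phi>"
    by (rule Bochner_Integration.integrable_bound[OF integrable_abs[OF g]])
      (auto simp: \<phi>_def indicator_def)
  have \<phi>: "(\<integral>\<^sup>+s. ennreal (\<phi> s) \<partial>circle_measure) \<le> ennreal (\<epsilon> / 2)"
    using n by (subst nn_integral_eq_integral[OF \<phi>_int]) (auto simp: \<phi>_def[abs_def] intro!: ennreal_leI)
  \<comment> \<open>Chosen so that (n + 1) \<delta> = \<epsilon>/2; the added 1 covers n =
    0.\<close>
  define \<delta> where "\<delta> = \<epsilon> / (2 * (real n + 1))"
  show ?thesis
  proof
    show "0 < \<delta>" using \<epsilon> by (simp add: \<delta>_def)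
    fix r :: real and E assume r: "0 \<le> r" "r < 1" and E [measurable]: "E \<in> sets circle_measure"
      and mE: "measure circle_measure E < \<delta>"
    note [measurable] = measurable_poisson_kernel[OF r]
    have pk1: "(\<lambda>s. poisson_kernel r s t) \<in> borel_measurable circle_measure"
      and pk2: "(\<lambda>s. poisson_kernel r t s) \<in> borel_measurable circle_measure"
      if "t \<in> space circle_measure" for t
      using measurable_compose[OF measurable_Pair2'[OF that] measurable_poisson_kernel[OF r]]
        measurable_compose[OF measurable_Pair1'[OF that] measurable_poisson_kernel[OF r]]
      by simp_all
    define \<Phi> where "\<Phi> s = (\<integral>\<^sup>+t. indicator E t * ennreal (poisson_kernel r s t) \<partial>circle_measure)" for s
    have \<Phi>m [measurable]: "\<Phi> \<in> borel_measurable circle_measure"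
    proof -
      have "(\<lambda>p. indicator E (snd p) * ennreal (poisson_kernel r (fst p) (snd p)))
          \<in> borel_measurable (circle_measure \<Otimes>\<^sub>M circle_measure)" by measurable
      then have "(\<lambda>(s, t). indicator E t * ennreal (poisson_kernel r s t))
          \<in> borel_measurable (circle_measure \<Otimes>\<^sub>M circle_measure)" by (simp add: case_prod_beta')
      from circle.borel_measurable_nn_integral[OF this] show ?thesis by (simp add: \<Phi>_def[abs_def])
    qed
    have fub: "(\<integral>\<^sup>+t. indicator E t * (\<integral>\<^sup>+s. ennreal (poisson_kernel r s t) * h s \<partial>circle_measure) \<partial>circle_measure)
        = (\<integral>\<^sup>+s. h s * \<Phi> s \<partial>circle_measure)" if h [measurable]: "h \<in> borel_measurable circle_measure" for h
    proof -
      have m: "(\<lambda>p. indicator E (snd p) * (ennreal (poisson_kernel r (fst p) (snd p)) * h (fst p)))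
          \<in> borel_measurable (circle_measure \<Otimes>\<^sub>M circle_measure)" by measurable
      have "(\<integral>\<^sup>+t. indicator E t * (\<integral>\<^sup>+s. ennreal (poisson_kernel r s t) * h s \<partial>circle_measure) \<partial>circle_measure)
        = (\<integral>\<^sup>+t. (\<integral>\<^sup>+s. indicator E t * (ennreal (poisson_kernel r s t) * h s) \<partial>circle_measure) \<partial>circle_measure)"
        using pk1 by (intro nn_integral_cong nn_integral_cmult[symmetric]) auto
      also have "\<dots> = (\<integral>\<^sup>+s. (\<integral>\<^sup>+t. indicator E t * (ennreal (poisson_kernel r s t) * h s) \<partial>circle_measure) \<partial>circle_measure)"
        using circle_pair.Fubini[OF m] by simp
      also have "\<dots> = (\<integral>\<^sup>+s. (\<integral>\<^sup>+t. h s * (indicator E t * ennreal (poisson_kernel r s t)) \<partial>circle_measure) \<partial>circle_measure)"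
        by (simp add: mult_ac)
      also have "\<dots> = (\<integral>\<^sup>+s. h s * \<Phi> s \<partial>circle_measure)"
        unfolding \<Phi>_def using pk2 by (intro nn_integral_cong nn_integral_cmult) auto
      finally show ?thesis .
    qed
    have \<Phi>1: "\<Phi> s \<le> 1" if "s \<in> space circle_measure" for s
    proof -
      have "\<Phi> s \<le> (\<integral>\<^sup>+t. ennreal (poisson_kernel r s t) \<partial>circle_measure)"
        unfolding \<Phi>_def by (intro nn_integral_mono) (auto simp: indicator_def)
      also have "\<dots> = 1"
        using that r by (intro nn_integral_poisson_kernel) (auto simp: space_circle_measure)
      finally show ?thesis .
    qed
    have \<Phi>E: "(\<integral>\<^sup>+s. \<Phi> s \<partial>circle_measure) = emeasure circle_measure E"
    proof -
      have "(\<integral>\<^sup>+s. \<Phi> s \<partial>circle_measure) =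
          (\<integral>\<^sup>+t. indicator E t * (\<integral>\<^sup>+s. ennreal (poisson_kernel r s t) \<partial>circle_measure) \<partial>circle_measure)"
        using fub[of "\<lambda>_. 1"] by simp
      also have "\<dots> = (\<integral>\<^sup>+t. indicator E t \<partial>circle_measure)"
      proof (rule nn_integral_cong)
        fix t assume t: "t \<in> space circle_measure"
        have "(\<integral>\<^sup>+s. ennreal (poisson_kernel r s t) \<partial>circle_measure) =
            (\<integral>\<^sup>+s. ennreal (poisson_kernel r t s) \<partial>circle_measure)"
          using t by (intro nn_integral_cong) (simp add: space_circle_measure poisson_kernel_commute)
        also have "\<dots> = 1"
          using t r by (intro nn_integral_poisson_kernel) (auto simp: space_circle_measure)
        finally show "indicator E t * (\<integral>\<^sup>+s. ennreal (poisson_kernel r s t) \<partial>circle_measure) = indicator E t"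
          by simp
      qed
      finally show ?thesis by simp
    qed
    have "(\<integral>\<^sup>+t. indicator E t * (\<integral>\<^sup>+s. ennreal (poisson_kernel r s t) * ennreal \<bar>g s\<bar> \<partial>circle_measure)
      \<partial>circle_measure) = (\<integral>\<^sup>+s. ennreal \<bar>g s\<bar> * \<Phi> s \<partial>circle_measure)"
      by (rule fub) measurable
    also have "\<dots> \<le> (\<integral>\<^sup>+s. ennreal (real n) * \<Phi> s + ennreal (\<phi> s) \<partial>circle_measure)"
    proof (rule nn_integral_mono)
      fix s assume s: "s \<in> space circle_measure"
      show "ennreal \<bar>g s\<bar> * \<Phi> s \<le> ennreal (real n) * \<Phi> s + ennreal (\<phi> s)"
      proof (cases "real n < \<bar>g s\<bar>")
        case True
        have "ennreal \<bar>g s\<bar> * \<Phi> s \<le> ennreal \<bar>g s\<bar> * 1"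
          by (intro mult_left_mono \<Phi>1 s) simp
        also have "\<dots> = ennreal (\<phi> s)" using True by (simp add: \<phi>_def)
        finally show ?thesis by (simp add: add_increasing)
      next
        case False
        then have "ennreal \<bar>g s\<bar> * \<Phi> s \<le> ennreal (real n) * \<Phi> s"
          by (intro mult_right_mono ennreal_leI) auto
        then show ?thesis by (simp add: add_increasing2)
      qed
    qed
    also have "\<dots> = ennreal (real n) * emeasure circle_measure E + (\<integral>\<^sup>+s. ennreal (\<phi> s) \<partial>circle_measure)"
      by (simp add: nn_integral_add nn_integral_cmult \<Phi>E)
    also have "\<dots> \<le> ennreal (real n * measure circle_measure E) + ennreal (\<epsilon> / 2)"
      using \<phi> by (intro add_mono) (simp_all add: circle.emeasure_eq_measure ennreal_mult)
    also have "\<dots> = ennreal (real n * measure circle_measure E + \<epsilon> / 2)"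
      using \<epsilon> by simp
    also have "\<dots> < ennreal \<epsilon>"
    proof (rule ennreal_lessI[OF \<epsilon>])
      have "real n * measure circle_measure E \<le> (real n + 1) * measure circle_measure E"
        by (simp add: mult_right_mono)
      also have "\<dots> < (real n + 1) * \<delta>"
        using mE by (intro mult_strict_left_mono) auto
      also have "\<dots> = \<epsilon> / 2"
        by (simp add: \<delta>_def divide_simps)
      finally show "real n * measure circle_measure E + \<epsilon> / 2 < \<epsilon>" by simp
    qed
    finally show "(\<integral>\<^sup>+t. indicator E t * (\<integral>\<^sup>+s. ennreal (poisson_kernel r s t) * ennreal \<bar>g s\<bar> \<partial>circle_measure)
      \<partial>circle_measure) < ennreal \<epsilon>" .
  qed
qed

text \<open>\<open>ennreal\<close> truncates at 0, so this is \<open>(- N - ln x)\<^sup>+\<close>; the junk value \<open>ln 0 = 0\<close> has to be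
  replaced.\<close>
definition log_excess :: "real \<Rightarrow> real \<Rightarrow> ennreal" where
  "log_excess N x = (if x = 0 then \<infinity> else ennreal (- N - ln x))"

lemma measurable_log_excess [measurable]: "log_excess N \<in> borel_measurable borel"
  unfolding log_excess_def[abs_def] by measurable

lemma ln_norm_outer_le:
  assumes e: "\<And>z. z \<in> ball 0 1 \<Longrightarrow>
      e z = C * exp (LINT t|circle_measure. (t + z) / (t - z) * complex_of_real (ln (w t)))"
    and C: "norm C = 1" and t: "norm t = 1" and r: "0 \<le> r" "r < 1"
  shows "e (of_real r * t) \<noteq> 0" and
    "ennreal \<bar>ln (norm (e (of_real r * t)))\<bar> \<le>
      (\<integral>\<^sup>+s. ennreal (poisson_kernel r s t) * ennreal \<bar>ln (w s)\<bar> \<partial>circle_measure)"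
proof -
  let ?z = "of_real r * t"
  define k where "k s = (s + ?z) / (s - ?z) * complex_of_real (ln (w s))" for s
  have z: "?z \<in> ball 0 1" using t r by (simp add: norm_mult)
  show "e ?z \<noteq> 0" using e[OF z] C by auto
  have "ln (norm (e ?z)) = Re (integral\<^sup>L circle_measure k)"
    unfolding e[OF z] k_def by (simp add: norm_mult C)
  \<comment> \<open>A non-integrable \<open>k\<close> has integral 0 by convention, and then the
    bound is trivial.\<close>
  also have "ennreal \<bar>\<dots>\<bar> \<le> (\<integral>\<^sup>+s. ennreal \<bar>Re (k s)\<bar> \<partial>circle_measure)"
  proof (cases "integrable circle_measure k")
    case True
    then show ?thesis
      using integral_norm_bound_ennreal[OF integrable_Re[OF True]] by simp
  next
    case False
    then show ?thesis by (simp add: not_integrable_integral_eq)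
  qed
  also have "\<dots> = (\<integral>\<^sup>+s. ennreal (poisson_kernel r s t) * ennreal \<bar>ln (w s)\<bar> \<partial>circle_measure)"
  proof (rule nn_integral_cong)
    fix s assume "s \<in> space circle_measure"
    then have "Re (k s) = poisson_kernel r s t * ln (w s)"
      using Re_herglotz_kernel[of s t r] t r
      by (simp only: k_def space_circle_measure times_complex.simps Re_complex_of_real Im_complex_of_real
          mult_zero_right diff_zero mem_sphere_0)
    then show "ennreal \<bar>Re (k s)\<bar> = ennreal (poisson_kernel r s t) * ennreal \<bar>ln (w s)\<bar>"
      using poisson_kernel_nonneg[OF r] by (simp add: abs_mult ennreal_mult)
  qed
  finally show "ennreal \<bar>ln (norm (e ?z))\<bar> \<le>
      (\<integral>\<^sup>+s. ennreal (poisson_kernel r s t) * ennreal \<bar>ln (w s)\<bar> \<partial>circle_measure)" .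
qed

lemma measure_sublevel_tendsto_0:
  fixes f :: "nat \<Rightarrow> complex \<Rightarrow> real"
  assumes [measurable]: "\<And>k. f k \<in> borel_measurable circle_measure"
    and lim: "AE t in circle_measure. (\<lambda>k. f k t) \<longlonglongrightarrow> 1" and c: "c < 1"
  shows "(\<lambda>k. measure circle_measure {t \<in> space circle_measure. f k t < c}) \<longlonglongrightarrow> 0"
proof -
  let ?E = "\<lambda>k. {t \<in> space circle_measure. f k t < c}"
  have "(\<lambda>k. LINT t|circle_measure. indicator (?E k) t :: real) \<longlonglongrightarrow> (LINT t|circle_measure. 0)"
  proof (rule integral_dominated_convergence[where w = "\<lambda>_. 1"])
    show "AE t in circle_measure. (\<lambda>k. indicator (?E k) t :: real) \<longlonglongrightarrow> 0"
      using lim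
    proof eventually_elim
      case (elim t)
      from order_tendstoD(1)[OF elim c] show ?case
        by (intro tendsto_eventually) (auto elim: eventually_mono simp: indicator_def)
    qed
  qed (auto simp: indicator_def)
  then show ?thesis by simp
qed

text \<open>Off a small set \<open>|\<theta>|\<close> is close to 1; on it, \<open>- ln |\<theta>| = ln |e| - ln |d|\<close>, where \<open>ln |e|\<close> is a
  Poisson integral.\<close>
lemma inner_factor_log_mean_small:
  fixes \<theta> e d :: "complex \<Rightarrow> complex"
  assumes outer: "outer_function e" and \<theta>: "continuous_on (ball 0 1) \<theta>"
    and \<theta>1: "\<And>z. norm z < 1 \<Longrightarrow> norm (\<theta> z) \<le> 1"
    and d_cont: "continuous_on (ball 0 1) d" and d: "\<And>z. norm z < 1 \<Longrightarrow> d z = e z * \<theta> z"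
    and rad: "AE t in circle_measure. ((\<lambda>r. norm (\<theta> (of_real r * t))) \<longlongrightarrow> 1) (at_left 1)"
    and \<rho>: "\<And>k :: nat. 0 < \<rho> k" "\<And>k. \<rho> k < 1" "\<rho> \<longlonglongrightarrow> 1"
    and excess: "\<And>\<epsilon>. 0 < \<epsilon> \<Longrightarrow> \<exists>N :: nat.
      liminf (\<lambda>k. \<integral>\<^sup>+t. log_excess N (norm (d (of_real (\<rho> k) * t))) \<partial>circle_measure) < ennreal \<epsilon>"
    and \<epsilon>: "0 < \<epsilon>"
  shows "\<exists>r. 0 < r \<and> r < 1 \<and>
    (\<integral>\<^sup>+t. log_excess 0 (norm (\<theta> (of_real r * t))) \<partial>circle_measure) < ennreal \<epsilon>"
proof -
  from outer obtain C w where C: "norm C = 1" and w: "integrable circle_measure (\<lambda>t. ln (w t))"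
    and e: "\<And>z. z \<in> ball 0 1 \<Longrightarrow>
      e z = C * exp (LINT t|circle_measure. (t + z) / (t - z) * complex_of_real (ln (w t)))"
    unfolding outer_function_def by blast
  \<comment> \<open>Four contributions are to be bounded by \<eta> each: the points off
    \<open>E k\<close>, and on \<open>E k\<close> the outer factor, the truncation level
    \<open>N\<close>, and the excess of \<open>d\<close>.\<close>
  define \<eta> where "\<eta> = \<epsilon> / 4"
  have \<eta>: "\<eta> > 0" using \<epsilon> by (simp add: \<eta>_def)
  obtain N :: nat where N: "liminf (\<lambda>k. \<integral>\<^sup>+t. log_excess N (norm (d (of_real (\<rho> k) * t))) \<partial>circle_measure) < ennreal \<eta>"
    using excess[OF \<eta>] by blast
  obtain \<delta> where \<delta>: "0 < \<delta>" "\<And>r E. 0 \<le> r \<Longrightarrow> r < 1 \<Longrightarrow> E \<in> sets circle_measure \<Longrightarrow>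
    measure circle_measure E < \<delta> \<Longrightarrow>
    (\<integral>\<^sup>+t. indicator E t * (\<integral>\<^sup>+s. ennreal (poisson_kernel r s t) * ennreal \<bar>ln (w s)\<bar> \<partial>circle_measure)
      \<partial>circle_measure) < ennreal \<eta>"
    using poisson_integrals_uniformly_integrable[OF w \<eta>] by blast
  define f where "f k t = norm (\<theta> (of_real (\<rho> k) * t))" for k t
  have fm [measurable]: "f k \<in> borel_measurable circle_measure" for k
    unfolding f_def using \<rho>(1,2)[of k]
    by (intro borel_measurable_circle_measure continuous_on_norm continuous_on_compose2[OF \<theta>])
      (auto intro!: continuous_intros simp: norm_mult)
  define E where "E k = {t \<in> space circle_measure. f k t < exp (- \<eta>)}" for k
  have Em [measurable]: "E k \<in> sets circle_measure" for k
    unfolding E_def by measurable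
  have \<rho>_at: "filterlim \<rho> (at_left 1) sequentially"
    using \<rho> by (intro tendsto_imp_filterlim_at_left) auto
  have "(\<lambda>k. measure circle_measure (E k)) \<longlonglongrightarrow> 0"
    unfolding E_def
  proof (rule measure_sublevel_tendsto_0[OF fm])
    show "AE t in circle_measure. (\<lambda>k. f k t) \<longlonglongrightarrow> 1"
      using rad by eventually_elim (auto simp: f_def intro: filterlim_compose[OF _ \<rho>_at])
  qed (use \<eta> in simp)
  \<comment> \<open>\<open>N\<close> and \<delta> are fixed by now, so \<open>E k\<close> may be
    made small relative to both; this is what pays for the term \<open>N\<close> times the measure
    of \<open>E k\<close>.\<close>
  then have ev: "eventually (\<lambda>k. measure circle_measure (E k) < min \<delta> (\<eta> / (real N + 1))) sequentially"
    using \<delta>(1) \<eta> by (intro order_tendstoD(2)) auto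
  \<comment> \<open>A small lower limit provides smallness for infinitely many \<open>k\<close>
    only, but one of them also meets the conditions on \<open>E k\<close>, which hold
    eventually.\<close>
  have "frequently (\<lambda>k. (\<integral>\<^sup>+t. log_excess N (norm (d (of_real (\<rho> k) * t))) \<partial>circle_measure) < ennreal \<eta>) sequentially"
  proof (rule ccontr)
    assume "\<not> ?thesis"
    then have "eventually (\<lambda>k. ennreal \<eta> \<le> (\<integral>\<^sup>+t. log_excess N (norm (d (of_real (\<rho> k) * t))) \<partial>circle_measure)) sequentially"
      by (simp add: frequently_def not_less)
    then have "ennreal \<eta> \<le> liminf (\<lambda>k. \<integral>\<^sup>+t. log_excess N (norm (d (of_real (\<rho> k) * t))) \<partial>circle_measure)"
      by (rule Liminf_bounded)
    with N show False by simp
  qed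
  from frequently_eventually_frequently[OF this ev]
  obtain k where k: "(\<integral>\<^sup>+t. log_excess N (norm (d (of_real (\<rho> k) * t))) \<partial>circle_measure) < ennreal \<eta>"
      "measure circle_measure (E k) < \<delta>" "measure circle_measure (E k) < \<eta> / (real N + 1)"
    by (auto dest: frequently_ex)
  let ?r = "\<rho> k"
  define U where "U t = (\<integral>\<^sup>+s. ennreal (poisson_kernel ?r s t) * ennreal \<bar>ln (w s)\<bar> \<partial>circle_measure)" for t
  have r: "0 \<le> ?r" "?r < 1" using \<rho>(1,2)[of k] by auto
  have Um [measurable]: "U \<in> borel_measurable circle_measure"
  proof -
    note [measurable] = measurable_poisson_kernel[OF r]
    have [measurable]: "(\<lambda>s. ln (w s)) \<in> borel_measurable circle_measure" using w by auto
    have "(\<lambda>p. ennreal (poisson_kernel ?r (fst p) (snd p)) * ennreal \<bar>ln (w (fst p))\<bar>)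
        \<in> borel_measurable (circle_measure \<Otimes>\<^sub>M circle_measure)" by measurable
    from circle.borel_measurable_nn_integral_fst[OF measurable_pair_swap[OF this]]
    show ?thesis by (simp add: U_def[abs_def] case_prod_beta')
  qed
  have pw: "log_excess 0 (f k t) \<le>
      ennreal \<eta> + (indicator (E k) t * U t + ennreal (real N) * indicator (E k) t) +
      log_excess N (norm (d (of_real ?r * t)))" if t: "t \<in> space circle_measure" for t
  proof -
    let ?z = "of_real ?r * t"
    have nt: "norm t = 1" and z: "norm ?z < 1"
      using t r by (auto simp: space_circle_measure norm_mult)
    note ez = ln_norm_outer_le[OF e C nt r]
    have dz: "d ?z = e ?z * \<theta> ?z" by (rule d[OF z])
    show ?thesis
    proof (cases "\<theta> ?z = 0")
      case True
      then show ?thesis by (simp add: dz log_excess_def)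
    next
      case False
      have fk: "f k t > 0" using False by (simp add: f_def)
      show ?thesis
      proof (cases "t \<in> E k")
        case True
        have "ln (norm (d ?z)) = ln (norm (e ?z)) + ln (f k t)"
          using False ez(1) by (simp add: dz norm_mult ln_mult f_def)
        then have "- ln (f k t) \<le> \<bar>ln (norm (e ?z))\<bar> + real N + max 0 (- real N - ln (norm (d ?z)))"
          by linarith
        moreover have "log_excess 0 (f k t) = ennreal (- ln (f k t))"
          using fk by (simp add: log_excess_def)
        ultimately have "log_excess 0 (f k t) \<le> ennreal (\<bar>ln (norm (e ?z))\<bar> + real N + max 0 (- real N - ln (norm (d ?z))))"
          by (simp only: ennreal_leI)
        also have "\<dots> = ennreal \<bar>ln (norm (e ?z))\<bar> + ennreal (real N) + log_excess N (norm (d ?z))"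
        proof -
          have "ennreal (max 0 x) = ennreal x" for x
            by (cases "0 \<le> x") (auto simp: ennreal_neg)
          then have "log_excess N (norm (d ?z)) = ennreal (max 0 (- real N - ln (norm (d ?z))))"
            using False ez(1) by (simp only: dz log_excess_def norm_eq_zero mult_eq_0_iff if_False simp_thms)
          then show ?thesis by simp
        qed
        also have "\<dots> \<le> (U t + ennreal (real N)) + log_excess N (norm (d ?z))"
          using ez(2) by (intro add_mono order_refl) (simp add: U_def)
        finally show ?thesis
          using True by (simp add: add.assoc add_increasing)
      next
        case notE: False
        then have "exp (- \<eta>) \<le> f k t" using t by (auto simp: E_def)
        then have "- \<eta> \<le> ln (f k t)" using fk by (simp add: ln_ge_iff)
        then have "log_excess 0 (f k t) \<le> ennreal \<eta>"
          using fk by (auto simp: log_excess_def intro!: ennreal_leI)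
        then show ?thesis by (simp add: add.assoc add_increasing2)
      qed
    qed
  qed
  have [measurable]: "(\<lambda>t. norm (d (of_real ?r * t))) \<in> borel_measurable circle_measure"
    using r by (intro borel_measurable_circle_measure continuous_on_norm continuous_on_compose2[OF d_cont])
      (auto intro!: continuous_intros simp: norm_mult)
  have "(\<integral>\<^sup>+t. log_excess 0 (f k t) \<partial>circle_measure) \<le>
      (\<integral>\<^sup>+t. ennreal \<eta> + (indicator (E k) t * U t + ennreal (real N) * indicator (E k) t) +
      log_excess N (norm (d (of_real ?r * t))) \<partial>circle_measure)"
    by (rule nn_integral_mono) (rule pw)
  also have "\<dots> = ennreal \<eta> + ((\<integral>\<^sup>+t. indicator (E k) t * U t \<partial>circle_measure) +
      ennreal (real N) * emeasure circle_measure (E k)) +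
      (\<integral>\<^sup>+t. log_excess N (norm (d (of_real ?r * t))) \<partial>circle_measure)"
    by (simp add: nn_integral_add nn_integral_cmult space_circle_measure emeasure_circle_measure_space)
  also have "\<dots> < ennreal \<eta> + (ennreal \<eta> + ennreal \<eta>) + ennreal \<eta>"
  proof -
    have "(\<integral>\<^sup>+t. indicator (E k) t * U t \<partial>circle_measure) < ennreal \<eta>"
      unfolding U_def by (rule \<delta>(2)[OF r Em k(2)])
    moreover have "ennreal (real N) * emeasure circle_measure (E k) \<le> ennreal \<eta>"
    proof -
      have "real N * measure circle_measure (E k) \<le> (real N + 1) * measure circle_measure (E k)"
        by (simp add: mult_right_mono)
      also have "\<dots> \<le> \<eta>" using k(3) by (simp add: field_simps)
      finally show ?thesis
        by (simp add: circle.emeasure_eq_measure ennreal_mult[symmetric] ennreal_leI)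
    qed
    ultimately have "ennreal \<eta> + ((\<integral>\<^sup>+t. indicator (E k) t * U t \<partial>circle_measure) +
        ennreal (real N) * emeasure circle_measure (E k)) +
        (\<integral>\<^sup>+t. log_excess N (norm (d (of_real ?r * t))) \<partial>circle_measure) \<le>
        (ennreal \<eta> + (ennreal \<eta> + ennreal \<eta>)) +
        (\<integral>\<^sup>+t. log_excess N (norm (d (of_real ?r * t))) \<partial>circle_measure)"
      by (intro add_mono order_refl) (auto simp: less_imp_le)
    also have "\<dots> < (ennreal \<eta> + (ennreal \<eta> + ennreal \<eta>)) + ennreal \<eta>"
      using k(1) by (simp add: ennreal_add_left_cancel_less)
    finally show ?thesis .
  qed
  also have "\<dots> = ennreal \<epsilon>"
    using \<eta> by (simp add: ennreal_plus[symmetric] \<eta>_def del: ennreal_plus)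
  finally show ?thesis
    using \<rho>(1,2)[of k] by (auto simp: f_def)
qed

section \<open>Logarithmic potentials of determinants\<close>

text \<open>Absence of atoms makes the pole of the logarithm negligible and later discards the
  finitely many degenerate shifts.\<close>

lemma finite_log_potential_AE:
  assumes "sets \<nu> = sets borel" "finite_log_potential \<nu> \<xi>"
  shows "AE x in \<nu>. x \<noteq> \<xi>"
  using assms by (intro AE_I'[of "{\<xi>}"]) (auto simp: finite_log_potential_def null_sets_def)

text \<open>Dini's theorem: the truncation errors decrease to 0 pointwise, they are continuous since the
  potential is, and they vanish away from the compact support.\<close>
lemma truncated_potential_uniformly_small:
  assumes "finite_measure \<nu>" and sets: "sets \<nu> = sets borel"
    and S: "compact S" "emeasure \<nu> (UNIV - S) = 0"
    and fin: "\<And>\<xi>. finite_log_potential \<nu> \<xi>" and cont: "continuous_on UNIV (log_potential \<nu>)"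
    and \<epsilon>: "0 < \<epsilon>"
  obtains N :: nat where "\<And>\<xi>. (\<integral>\<^sup>+x. log_excess N (norm (\<xi> - x)) \<partial>\<nu>) \<le> ennreal \<epsilon>"
proof -
  interpret finite_measure \<nu> by fact
  have [measurable_cong]: "sets \<nu> = sets borel" by fact
  have space: "space \<nu> = UNIV" using sets_eq_imp_space_eq[OF sets] by simp
  \<comment> \<open>The logarithm cut off at -N. With the maximum inside the logarithm,
    \<open>s = 0\<close> gives -N instead of the default \<open>ln 0 = 0\<close>, and the function
    is Lipschitz with constant \<open>exp N\<close>, whence the truncated potentials are
    continuous.\<close>
  define c where "c N s = ln (max s (exp (- real N)))" for N s
  define T where "T N \<xi> = (LINT x|\<nu>. c N (norm (\<xi> - x)))" for N \<xi>
  define G where "G N \<xi> = T N \<xi> - log_potential \<nu> \<xi>" for N \<xi>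
  have c_eq: "c N s = max (ln s) (- real N)" if "0 < s" for N s
    using that ln_le_cancel_iff[of s "exp (- real N)"] by (auto simp: c_def max_def)
  have c_le: "\<bar>c N s\<bar> \<le> real N + \<bar>ln s\<bar>" if "0 \<le> s" for N s
    using that by (cases "s = 0") (auto simp: c_eq, auto simp: c_def)
  have ln_int: "integrable \<nu> (\<lambda>x. ln (norm (\<xi> - x)))" for \<xi>
    using fin[of \<xi>] by (simp add: finite_log_potential_def)
  have c_int: "integrable \<nu> (\<lambda>x. c N (norm (\<xi> - x)))" for N \<xi>
  proof (rule Bochner_Integration.integrable_bound)
    show "integrable \<nu> (\<lambda>x. real N + \<bar>ln (norm (\<xi> - x))\<bar>)"
      using ln_int by (intro Bochner_Integration.integrable_add integrable_abs) auto
    show "(\<lambda>x. c N (norm (\<xi> - x))) \<in> borel_measurable \<nu>"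
      unfolding c_def by measurable
    show "AE x in \<nu>. norm (c N (norm (\<xi> - x))) \<le> norm (real N + \<bar>ln (norm (\<xi> - x))\<bar>)"
      by (rule AE_I2) (simp add: c_le)
  qed
  have c_lip: "\<bar>c N s - c N s'\<bar> \<le> exp (real N) * \<bar>s - s'\<bar>" for N s s'
  proof -
    have *: "c N u - c N v \<le> exp (real N) * (u - v)" if "v \<le> u" for u v
    proof -
      define a b where "a = max v (exp (- real N))" and "b = max u (exp (- real N))"
      have "0 < a" by (simp add: a_def less_max_iff_disj)
      moreover have "exp (- real N) \<le> a" "a \<le> b" "b - a \<le> u - v"
        using that by (auto simp: a_def b_def max_def)
      ultimately have ab: "0 < a" "exp (- real N) \<le> a" "a \<le> b" "b - a \<le> u - v" .
      have "c N u - c N v = ln (b / a)"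
        using ab by (simp add: c_def a_def b_def ln_div)
      also have "\<dots> \<le> b / a - 1"
        using ab by (intro ln_le_minus_one) auto
      also have "\<dots> = (1 / a) * (b - a)" using ab by (simp add: field_simps)
      also have "\<dots> \<le> exp (real N) * (u - v)"
      proof (rule mult_mono)
        have "1 / a \<le> 1 / exp (- real N)" using ab by (intro divide_left_mono) auto
        then show "1 / a \<le> exp (real N)" by (simp add: exp_minus field_simps)
      qed (use ab in auto)
      finally show ?thesis .
    qed
    have mono: "c N v \<le> c N u" if "v \<le> u" for u v
      unfolding c_def by (intro ln_mono max.mono) (auto simp: that less_max_iff_disj)
    show ?thesis
      using *[of s s'] *[of s' s] mono[of s s'] mono[of s' s] by (cases "s \<le> s'") (auto simp: abs_if)
  qed
  have T_cont: "continuous_on UNIV (T N)" for N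
  proof -
    have "dist (T N \<xi>) (T N \<xi>') \<le> (exp (real N) * measure \<nu> (space \<nu>)) * dist \<xi> \<xi>'" for \<xi> \<xi>'
    proof -
      have "dist (T N \<xi>) (T N \<xi>') = norm (LINT x|\<nu>. c N (norm (\<xi> - x)) - c N (norm (\<xi>' - x)))"
        unfolding T_def dist_norm by (simp add: Bochner_Integration.integral_diff[OF c_int c_int])
      also have "\<dots> \<le> (LINT x|\<nu>. norm (c N (norm (\<xi> - x)) - c N (norm (\<xi>' - x))))"
        by (rule integral_norm_bound)
      also have "\<dots> \<le> (LINT x|\<nu>. exp (real N) * dist \<xi> \<xi>')"
      proof (rule integral_mono)
        fix x
        have "norm (c N (norm (\<xi> - x)) - c N (norm (\<xi>' - x))) \<le> exp (real N) * \<bar>norm (\<xi> - x) - norm (\<xi>' - x)\<bar>"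
          using c_lip by simp
        also have "\<dots> \<le> exp (real N) * dist \<xi> \<xi>'"
          using norm_triangle_ineq3[of "\<xi> - x" "\<xi>' - x"] by (simp add: dist_norm)
        finally show "norm (c N (norm (\<xi> - x)) - c N (norm (\<xi>' - x))) \<le> exp (real N) * dist \<xi> \<xi>'" .
      qed (use c_int in auto)
      finally show ?thesis by (simp add: mult_ac)
    qed
    then have "(exp (real N) * measure \<nu> (space \<nu>))-lipschitz_on UNIV (T N)"
      by (intro lipschitz_onI) auto
    then show ?thesis by (rule lipschitz_on_continuous_on)
  qed
  have G_cont: "continuous_on UNIV (G N)" for N
    unfolding G_def using T_cont cont by (intro continuous_intros)
  have diff_int: "integrable \<nu> (\<lambda>x. c N (norm (\<xi> - x)) - ln (norm (\<xi> - x)))" for N \<xi>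
    by (intro Bochner_Integration.integrable_diff c_int ln_int)
  have G_eq: "G N \<xi> = (LINT x|\<nu>. c N (norm (\<xi> - x)) - ln (norm (\<xi> - x)))" for N \<xi>
    unfolding G_def T_def log_potential_def
    by (rule Bochner_Integration.integral_diff[OF c_int ln_int, symmetric])
  have ne: "AE x in \<nu>. x \<noteq> \<xi>" for \<xi>
    by (rule finite_log_potential_AE[OF sets fin])
  have excess: "(\<integral>\<^sup>+x. log_excess N (norm (\<xi> - x)) \<partial>\<nu>) = ennreal (G N \<xi>)" for N \<xi>
  proof -
    have "(\<integral>\<^sup>+x. log_excess N (norm (\<xi> - x)) \<partial>\<nu>) = (\<integral>\<^sup>+x. ennreal (c N (norm (\<xi> - x)) - ln (norm (\<xi> - x))) \<partial>\<nu>)"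
      by (rule nn_integral_cong_AE, use ne[of \<xi>] in eventually_elim)
        (auto simp: log_excess_def c_eq max_def ennreal_neg)
    also have "\<dots> = ennreal (G N \<xi>)"
      unfolding G_eq
      by (rule nn_integral_eq_integral[OF diff_int], use ne[of \<xi>] in eventually_elim) (auto simp: c_eq)
    finally show ?thesis .
  qed
  have anti: "G N' \<xi> \<le> G N \<xi>" if "N \<le> N'" for N N' \<xi>
  proof -
    have "c N' s \<le> c N s" for s
      unfolding c_def using that by (intro ln_mono max.mono) (auto simp: less_max_iff_disj)
    then show ?thesis unfolding G_eq by (intro integral_mono diff_int) simp
  qed
  have lim: "(\<lambda>N. G N \<xi>) \<longlonglongrightarrow> 0" for \<xi>
  proof -
    have "(\<lambda>N. LINT x|\<nu>. c N (norm (\<xi> - x)) - ln (norm (\<xi> - x))) \<longlonglongrightarrow> (LINT x|\<nu>. 0)"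
    proof (rule integral_dominated_convergence[where w = "\<lambda>x. 2 * \<bar>ln (norm (\<xi> - x))\<bar>"])
      show "(\<lambda>x. c N (norm (\<xi> - x)) - ln (norm (\<xi> - x))) \<in> borel_measurable \<nu>" for N
        using diff_int by auto
      show "integrable \<nu> (\<lambda>x. 2 * \<bar>ln (norm (\<xi> - x))\<bar>)"
        using ln_int by (intro integrable_mult_right integrable_abs) auto
      show "AE x in \<nu>. (\<lambda>N. c N (norm (\<xi> - x)) - ln (norm (\<xi> - x))) \<longlonglongrightarrow> 0"
        using ne[of \<xi>]
      proof eventually_elim
        case (elim x)
        obtain N0 :: nat where N0: "- ln (norm (\<xi> - x)) \<le> real N0" using real_arch_simple by blast
        then have "c N (norm (\<xi> - x)) - ln (norm (\<xi> - x)) = 0" if "N0 \<le> N" for N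
          using that elim by (auto simp: c_eq max_def)
        then show ?case by (intro tendsto_eventually eventually_sequentiallyI[of N0]) auto
      qed
      show "AE x in \<nu>. norm (c N (norm (\<xi> - x)) - ln (norm (\<xi> - x))) \<le> 2 * \<bar>ln (norm (\<xi> - x))\<bar>" for N
        using ne[of \<xi>] by eventually_elim (auto simp: c_eq max_def)
    qed auto
    then show ?thesis unfolding G_eq by simp
  qed
  \<comment> \<open>Beyond distance 1 from \<open>S\<close> the logarithm is nonnegative on
    \<open>S\<close>, so the excess vanishes and compactness is needed only on this
    neighbourhood.\<close>
  define C where "C = {s + u |s u. s \<in> S \<and> u \<in> cball 0 (1 :: real)}"
  have "compact C" unfolding C_def by (intro compact_sums S) simp
  moreover have "open {\<xi>. G N \<xi> < \<epsilon>}" for N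
    by (intro open_Collect_less G_cont continuous_on_const)
  moreover have "C \<subseteq> (\<Union>N. {\<xi>. G N \<xi> < \<epsilon>})"
  proof
    fix \<xi>
    from order_tendstoD(2)[OF lim \<epsilon>] obtain N where "G N \<xi> < \<epsilon>"
      by (auto simp: eventually_sequentially)
    then show "\<xi> \<in> (\<Union>N. {\<xi>. G N \<xi> < \<epsilon>})" by blast
  qed
  ultimately obtain D where D: "finite D" "C \<subseteq> (\<Union>N\<in>D. {\<xi>. G N \<xi> < \<epsilon>})"
    using compactE_image[of C UNIV "\<lambda>N. {\<xi>. G N \<xi> < \<epsilon>}"] by (metis subset_UNIV)
  define N where "N = Max (insert 0 D)"
  have "(\<integral>\<^sup>+x. log_excess N (norm (\<xi> - x)) \<partial>\<nu>) \<le> ennreal \<epsilon>" for \<xi>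
  proof (cases "\<xi> \<in> C")
    case True
    with D obtain N' where "N' \<in> D" "G N' \<xi> < \<epsilon>" by blast
    moreover have "N' \<le> N" using D(1) \<open>N' \<in> D\<close> by (simp add: N_def)
    ultimately have "G N \<xi> \<le> \<epsilon>" using anti[of N' N \<xi>] by simp
    then show ?thesis unfolding excess by (rule ennreal_leI)
  next
    case False
    have "AE x in \<nu>. x \<in> S"
      using S(2) compact_imp_closed[OF S(1)]
      by (intro AE_I[of _ _ "UNIV - S"]) (auto simp: sets space)
    then have "AE x in \<nu>. log_excess N (norm (\<xi> - x)) = 0"
    proof eventually_elim
      case (elim x)
      have "1 < norm (\<xi> - x)"
      proof (rule ccontr)
        assume "\<not> ?thesis"
        then have "\<xi> = x + (\<xi> - x) \<and> x \<in> S \<and> \<xi> - x \<in> cball 0 1" using elim by auto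
        then show False using False unfolding C_def by blast
      qed
      then have "0 \<le> ln (norm (\<xi> - x))" by simp
      then have "- real N - ln (norm (\<xi> - x)) \<le> 0" by linarith
      then show ?case
        using \<open>1 < norm (\<xi> - x)\<close> by (auto simp: log_excess_def intro!: ennreal_neg)
    qed
    then have "(\<integral>\<^sup>+x. log_excess N (norm (\<xi> - x)) \<partial>\<nu>) = 0"
      by (simp add: nn_integral_0_iff_AE)
    then show ?thesis by simp
  qed
  then show ?thesis by (rule that)
qed

text \<open>The logarithm of the product splits, and so does the level once each factor receives
  \<open>N\<close>; the positive part is subadditive. Zero factors make the right side
  infinite.\<close>

lemma log_excess_prod_le:
  fixes x :: "'i \<Rightarrow> real"
  assumes "finite I" "\<And>i. i \<in> I \<Longrightarrow> 0 \<le> x i"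
  shows "log_excess (real (card I) * N) (\<Prod>i\<in>I. x i) \<le> (\<Sum>i\<in>I. log_excess N (x i))"
proof (cases "\<exists>i\<in>I. x i = 0")
  case True
  then obtain i where i: "i \<in> I" "x i = 0" by blast
  then have "(\<Sum>i\<in>I. log_excess N (x i)) = \<infinity>"
    using member_le_sum[of i I "\<lambda>i. log_excess N (x i)"] assms
    by (simp add: log_excess_def top_unique)
  then show ?thesis by simp
next
  case False
  then have pos: "0 < x i" if "i \<in> I" for i using assms(2)[OF that] that by force
  have nz: "x i \<noteq> 0" if "i \<in> I" for i using pos[OF that] by simp
  have "ln (\<Prod>i\<in>I. x i) = (\<Sum>i\<in>I. ln (x i))"
    by (rule ln_prod) (use assms nz in auto)
  then have "- (real (card I) * N) - ln (\<Prod>i\<in>I. x i) = (\<Sum>i\<in>I. - N - ln (x i))"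
    by (simp add: sum_subtractf)
  also have "\<dots> \<le> (\<Sum>i\<in>I. max 0 (- N - ln (x i)))"
    by (rule sum_mono) simp
  finally have "log_excess (real (card I) * N) (\<Prod>i\<in>I. x i) \<le> ennreal (\<Sum>i\<in>I. max 0 (- N - ln (x i)))"
    using nz assms(1) by (simp add: log_excess_def ennreal_leI)
  also have "\<dots> = (\<Sum>i\<in>I. ennreal (max 0 (- N - ln (x i))))"
    by (simp add: sum_ennreal)
  also have "\<dots> = (\<Sum>i\<in>I. log_excess N (x i))"
    using nz by (intro sum.cong refl) (auto simp: log_excess_def max_def ennreal_neg)
  finally show ?thesis .
qed

section \<open>The characteristic polynomial and its roots\<close>

lemma det_shift_eq_poly:
  fixes M :: "complex^'n^'n"
  obtains D :: "complex poly" where "\<And>\<mu>. poly D \<mu> = det (M - mat \<mu>)"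
    "degree D = CARD('n)" "norm (lead_coeff D) = 1"
proof -
  define X where "X i j = [:M $ i $ j, if i = j then - 1 else 0:]" for i j
  define t where "t p = of_int (sign p) * (\<Prod>i\<in>UNIV. X i (p i))" for p
  define D where "D = (\<Sum>p\<in>{p. p permutes (UNIV :: 'n set)}. t p)"
  have "poly D \<mu> = det (M - mat \<mu>)" for \<mu>
    unfolding D_def det_def poly_sum t_def
  proof (rule sum.cong[OF refl])
    fix p
    have "poly (X i j) \<mu> = (M - mat \<mu>) $ i $ j" for i j
      by (simp add: X_def mat_def)
    then show "poly (of_int (sign p) * (\<Prod>i\<in>UNIV. X i (p i))) \<mu> =
        of_int (sign p) * (\<Prod>i\<in>UNIV. (M - mat \<mu>) $ i $ p i)"
      by (simp add: poly_prod)
  qed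
  moreover have "coeff D CARD('n) = (- 1) ^ CARD('n)"
  proof -
    \<comment> \<open>A permutation that moves some index picks an off-diagonal entry, constant in
      \<mu>, so its Leibniz term has degree below the dimension; the leading coefficient comes from
      the diagonal alone.\<close>
    have other: "coeff (t p) CARD('n) = 0" if p: "p permutes UNIV" "p \<noteq> id" for p
    proof (rule coeff_eq_0)
      have "degree (t p) \<le> degree (\<Prod>i\<in>UNIV. X i (p i))"
        by (auto simp: t_def sign_def)
      also have "\<dots> \<le> (\<Sum>i\<in>UNIV. degree (X i (p i)))"
        using degree_prod_sum_le[of UNIV "\<lambda>i. X i (p i)"] by (simp add: o_def)
      also have "\<dots> < (\<Sum>i\<in>(UNIV :: 'n set). 1)"
      proof (rule sum_strict_mono_ex1)
        obtain i where "p i \<noteq> i" using p(2) by fastforce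
        then show "\<exists>i\<in>UNIV. degree (X i (p i)) < 1" by (intro bexI[of _ i]) (auto simp: X_def)
      qed (auto simp: X_def)
      finally show "degree (t p) < CARD('n)" by simp
    qed
    have "coeff D CARD('n) = (\<Sum>p\<in>{p. p permutes (UNIV :: 'n set)}. coeff (t p) CARD('n))"
      by (simp add: D_def coeff_sum)
    also have "\<dots> = (\<Sum>p\<in>{id}. coeff (t p) CARD('n))"
      by (rule sum.mono_neutral_right) (auto simp: other permutes_id finite_permutations)
    also have "\<dots> = coeff (\<Prod>i\<in>UNIV. X i i) CARD('n)"
      by (simp add: t_def)
    also have "\<dots> = lead_coeff (\<Prod>i\<in>UNIV. X i i)"
      by (subst degree_prod_eq_sum_degree) (auto simp: X_def)
    also have "\<dots> = (- 1) ^ CARD('n)"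
      by (simp add: lead_coeff_prod X_def)
    finally show ?thesis .
  qed
  moreover have "degree D \<le> CARD('n)"
    unfolding D_def
  proof (rule degree_sum_le)
    fix p
    have "degree (t p) \<le> degree (\<Prod>i\<in>UNIV. X i (p i))"
      by (auto simp: t_def sign_def)
    also have "\<dots> \<le> (\<Sum>i\<in>UNIV. degree (X i (p i)))"
      using degree_prod_sum_le[of UNIV "\<lambda>i. X i (p i)"] by (simp add: o_def)
    also have "\<dots> \<le> (\<Sum>i\<in>(UNIV :: 'n set). 1)"
      by (rule sum_mono) (simp add: X_def)
    finally show "degree (t p) \<le> CARD('n)" by simp
  qed (simp add: finite_permutations)
  ultimately show ?thesis
    using that[of D] le_degree[of D "CARD('n)"] by (simp add: norm_power)
qed

lemma det_shift_eq_prod: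
  fixes M :: "complex^'n^'n"
  obtains root :: "nat \<Rightarrow> complex" where "\<And>\<mu>. norm (det (M - mat \<mu>)) = (\<Prod>i<CARD('n). norm (root i - \<mu>))"
proof -
  obtain D where D: "\<And>\<mu>. poly D \<mu> = det (M - mat \<mu>)" "degree D = CARD('n)" "norm (lead_coeff D) = 1"
    using det_shift_eq_poly[of M] by blast
  obtain root where root: "smult (lead_coeff D) (\<Prod>i<degree D. [:- root i, 1:]) = D"
    using complex_poly_decompose' by blast
  have "norm (det (M - mat \<mu>)) = (\<Prod>i<CARD('n). norm (root i - \<mu>))" for \<mu>
  proof -
    have "det (M - mat \<mu>) = poly (smult (lead_coeff D) (\<Prod>i<degree D. [:- root i, 1:])) \<mu>"
      unfolding root D(1) ..
    also have "norm \<dots> = (\<Prod>i<CARD('n). norm (root i - \<mu>))"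
      by (simp add: poly_prod norm_mult D(2) D(3)[unfolded D(2)] prod_norm[symmetric] norm_minus_commute)
    finally show ?thesis .
  qed
  then show ?thesis by (rule that)
qed

lemma finite_det_shift_zeros:
  fixes M :: "complex^'n^'n"
  shows "finite {\<mu>. det (M - mat \<mu>) = 0}"
proof -
  obtain root where root: "\<And>\<mu>. norm (det (M - mat \<mu>)) = (\<Prod>i<CARD('n). norm (root i - \<mu>))"
    using det_shift_eq_prod[of M] by blast
  have "{\<mu>. det (M - mat \<mu>) = 0} \<subseteq> root ` {..<CARD('n)}"
  proof
    fix \<mu> assume "\<mu> \<in> {\<mu>. det (M - mat \<mu>) = 0}"
    then have "(\<Prod>i<CARD('n). norm (root i - \<mu>)) = 0" using root[of \<mu>] by simp
    then show "\<mu> \<in> root ` {..<CARD('n)}" by auto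
  qed
  then show ?thesis by (rule finite_subset) simp
qed

text \<open>With \<open>M\<close> held fixed its eigenvalues are constants in the integral over
  \<mu>, so no measurable choice of eigenvalues along the disc arises, and the hypothesis at every
  \<xi> makes the bound independent of \<open>M\<close>.\<close>

lemma nn_integral_log_excess_det_shift_le:
  fixes M :: "complex^'n^'n"
  assumes sets: "sets \<nu> = sets borel"
    and N: "\<And>\<xi>. (\<integral>\<^sup>+x. log_excess N (norm (\<xi> - x)) \<partial>\<nu>) \<le> c"
  shows "(\<integral>\<^sup>+\<mu>. log_excess (real CARD('n) * N) (norm (det (M - mat \<mu>))) \<partial>\<nu>) \<le> of_nat CARD('n) * c"
proof -
  have [measurable_cong]: "sets \<nu> = sets borel" by fact
  obtain root where root: "\<And>\<mu>. norm (det (M - mat \<mu>)) = (\<Prod>i<CARD('n). norm (root i - \<mu>))"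
    using det_shift_eq_prod[of M] by blast
  have "(\<integral>\<^sup>+\<mu>. log_excess (real CARD('n) * N) (norm (det (M - mat \<mu>))) \<partial>\<nu>) \<le>
      (\<integral>\<^sup>+\<mu>. (\<Sum>i<CARD('n). log_excess N (norm (root i - \<mu>))) \<partial>\<nu>)"
    unfolding root
    using log_excess_prod_le[of "{..<CARD('n)}" "\<lambda>i. norm (root i - _)" N]
    by (intro nn_integral_mono) simp
  also have "\<dots> = (\<Sum>i<CARD('n). \<integral>\<^sup>+\<mu>. log_excess N (norm (root i - \<mu>)) \<partial>\<nu>)"
    by (rule nn_integral_sum) measurable
  also have "\<dots> \<le> (\<Sum>i<CARD('n). c)"
    by (intro sum_mono N)
  finally show ?thesis by simp
qed

section \<open>Frostman shifts\<close>

text \<open>Jensen's formula for the zero-free \<open>g\<close> bounds -ln |g(0)| by the logarithmic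
  mean of \<theta>. This is how the absence of a singular part is used: \<open>g\<close> will be the
  determinant of a remainder.\<close>

lemma norm_at_0_ge_of_log_mean:
  fixes g \<theta> :: "complex \<Rightarrow> complex"
  assumes g: "g holomorphic_on ball 0 1" and nz: "\<And>z. norm z < R \<Longrightarrow> g z \<noteq> 0" and R: "R \<le> 1"
    and r: "0 < r" "r < R"
    and le: "\<And>z. norm z < 1 \<Longrightarrow> norm (\<theta> z) \<le> norm (g z)" "\<And>z. norm z < 1 \<Longrightarrow> norm (g z) \<le> 1"
    and mean: "(\<integral>\<^sup>+t. log_excess 0 (norm (\<theta> (of_real r * t))) \<partial>circle_measure) < ennreal \<epsilon>"
  shows "1 - \<epsilon> \<le> norm (g 0)"
proof -
  have gR: "g holomorphic_on ball 0 R"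
    by (rule holomorphic_on_subset[OF g]) (use R in auto)
  have r0: "0 \<le> r" using r by simp
  note int = integral_circle_measure_ln_norm[OF gR nz r0 r(2)]
  have pt: "g (of_real r * t) \<noteq> 0" "norm (g (of_real r * t)) \<le> 1" "norm (\<theta> (of_real r * t)) \<le> norm (g (of_real r * t))"
    if "t \<in> space circle_measure" for t
    using that r R by (auto intro!: nz le simp: space_circle_measure norm_mult)
  have "ennreal (- ln (norm (g 0))) = ennreal (LINT t|circle_measure. - ln (norm (g (of_real r * t))))"
    using int(2) by simp
  also have "\<dots> = (\<integral>\<^sup>+t. ennreal (- ln (norm (g (of_real r * t)))) \<partial>circle_measure)"
    by (rule nn_integral_eq_integral[symmetric]) (use int(1) pt in auto)
  also have "\<dots> \<le> (\<integral>\<^sup>+t. log_excess 0 (norm (\<theta> (of_real r * t))) \<partial>circle_measure)"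
  proof (rule nn_integral_mono)
    fix t assume t: "t \<in> space circle_measure"
    show "ennreal (- ln (norm (g (of_real r * t)))) \<le> log_excess 0 (norm (\<theta> (of_real r * t)))"
      using pt[OF t] by (auto simp: log_excess_def intro!: ennreal_leI)
  qed
  also have "\<dots> < ennreal \<epsilon>" by (rule mean)
  finally have "- ln (norm (g 0)) < \<epsilon>"
    by (metis ennreal_leI not_less)
  then have "exp (- \<epsilon>) \<le> norm (g 0)"
    using nz[of 0] r by (simp add: ln_ge_iff[symmetric])
  then show ?thesis using exp_ge_add_one_self[of "- \<epsilon>"] by simp
qed

text \<open>Frostman's argument: average the excess over \<open>\<nu>\<close> first.\<close>
lemma AE_det_shift_log_excess_small:
  fixes F :: "complex \<Rightarrow> complex^'n^'n"
  assumes F: "matrix_holomorphic F"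
    and \<nu>: "finite_measure \<nu>" "sets \<nu> = sets borel" "compact S" "emeasure \<nu> (UNIV - S) = 0"
      "\<And>\<xi>. finite_log_potential \<nu> \<xi>" "continuous_on UNIV (log_potential \<nu>)"
    and \<rho>: "\<And>k :: nat. 0 < \<rho> k" "\<And>k. \<rho> k < 1"
  shows "AE \<mu> in \<nu>. \<forall>\<epsilon>>0. \<exists>N :: nat.
    liminf (\<lambda>k. \<integral>\<^sup>+t. log_excess N (norm (det (F (of_real (\<rho> k) * t) - mat \<mu>))) \<partial>circle_measure) < ennreal \<epsilon>"
proof -
  interpret finite_measure \<nu> by fact
  interpret pair: pair_sigma_finite \<nu> circle_measure ..
  have sets [measurable_cong]: "sets \<nu> = sets borel" by fact
  define d where "d k \<mu> t = norm (det (F (of_real (\<rho> k) * t) - mat \<mu>))" for k \<mu> t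
  have Fm [measurable]: "(\<lambda>t. F (of_real (\<rho> k) * t) $ i $ j) \<in> borel_measurable circle_measure" for k i j
  proof -
    have "continuous_on (ball 0 1) (\<lambda>z. F z $ i $ j)"
      using F by (auto simp: matrix_holomorphic_def intro: holomorphic_on_imp_continuous_on)
    then show ?thesis
      by (intro borel_measurable_circle_measure, rule continuous_on_compose2)
        (use \<rho>[of k] in \<open>auto intro!: continuous_intros simp: norm_mult\<close>)
  qed
  have dm [measurable]: "(\<lambda>p. d k (fst p) (snd p)) \<in> borel_measurable (\<nu> \<Otimes>\<^sub>M circle_measure)" for k
  proof -
    have "(\<lambda>p. (F (of_real (\<rho> k) * snd p) - mat (fst p)) $ i $ j) \<in> borel_measurable (\<nu> \<Otimes>\<^sub>M circle_measure)" for i j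
      by (cases "i = j") (simp_all add: mat_entry)
    note [measurable] = this
    show ?thesis unfolding d_def det_def by measurable
  qed
  define X where "X N k \<mu> = (\<integral>\<^sup>+t. log_excess N (d k \<mu> t) \<partial>circle_measure)" for N :: real and k \<mu>
  have Xm [measurable]: "X N k \<in> borel_measurable \<nu>" for N k
  proof -
    have "(\<lambda>p. log_excess N (d k (fst p) (snd p))) \<in> borel_measurable (\<nu> \<Otimes>\<^sub>M circle_measure)" by measurable
    from circle.borel_measurable_nn_integral_fst[OF this] show ?thesis by (simp add: X_def[abs_def])
  qed
  define Q where "Q N \<mu> = liminf (\<lambda>k. X N k \<mu>)" for N \<mu>
  have Qm [measurable]: "Q N \<in> borel_measurable \<nu>" for N
    unfolding Q_def by measurable
  \<comment> \<open>A countable infimum keeps measurability and puts all \<epsilon> and all levels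
    into one null set: the excess can be made arbitrarily small at \<mu> exactly when
    \<open>R \<mu>\<close> vanishes.\<close>
  define R where "R \<mu> = (INF N :: nat. Q (real N) \<mu>)" for \<mu>
  have Rm [measurable]: "R \<in> borel_measurable \<nu>"
    unfolding R_def by measurable
  have "(\<integral>\<^sup>+\<mu>. R \<mu> \<partial>\<nu>) \<le> 0 + ennreal \<epsilon>" if \<epsilon>: "0 < \<epsilon>" for \<epsilon>
  proof -
    have "0 < \<epsilon> / CARD('n)" using \<epsilon> by simp
    then obtain N :: nat where N: "\<And>\<xi>. (\<integral>\<^sup>+x. log_excess N (norm (\<xi> - x)) \<partial>\<nu>) \<le> ennreal (\<epsilon> / CARD('n))"
      using truncated_potential_uniformly_small[OF \<nu>] by blast
    \<comment> \<open>The determinant is a product of as many factors as the dimension: the level is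
      multiplied by that number, and \<epsilon> was divided by it.\<close>
    let ?N = "CARD('n) * N"
    have X: "(\<integral>\<^sup>+\<mu>. X ?N k \<mu> \<partial>\<nu>) \<le> ennreal \<epsilon>" for k
    proof -
      have "(\<lambda>p. log_excess ?N (d k (fst p) (snd p))) \<in> borel_measurable (\<nu> \<Otimes>\<^sub>M circle_measure)" by measurable
      then have "(\<integral>\<^sup>+\<mu>. X ?N k \<mu> \<partial>\<nu>) = (\<integral>\<^sup>+t. (\<integral>\<^sup>+\<mu>. log_excess ?N (d k \<mu> t) \<partial>\<nu>) \<partial>circle_measure)"
        unfolding X_def by (subst pair.Fubini'[symmetric]) (auto simp: case_prod_beta')
      also have "\<dots> \<le> (\<integral>\<^sup>+t. ennreal \<epsilon> \<partial>circle_measure)"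
      proof (rule nn_integral_mono)
        fix t
        have "(\<integral>\<^sup>+\<mu>. log_excess ?N (d k \<mu> t) \<partial>\<nu>) \<le> of_nat CARD('n) * ennreal (\<epsilon> / CARD('n))"
          using nn_integral_log_excess_det_shift_le[OF sets N, of "F (of_real (\<rho> k) * t)"]
          by (simp add: d_def)
        also have "\<dots> = ennreal \<epsilon>"
          using \<epsilon> by (simp add: ennreal_of_nat_eq_real_of_nat ennreal_mult[symmetric])
        finally show "(\<integral>\<^sup>+\<mu>. log_excess ?N (d k \<mu> t) \<partial>\<nu>) \<le> ennreal \<epsilon>" .
      qed
      also have "\<dots> = ennreal \<epsilon>" by (simp add: space_circle_measure emeasure_circle_measure_space)
      finally show ?thesis .
    qed
    have "(\<integral>\<^sup>+\<mu>. R \<mu> \<partial>\<nu>) \<le> (\<integral>\<^sup>+\<mu>. Q ?N \<mu> \<partial>\<nu>)"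
      unfolding R_def by (intro nn_integral_mono INF_lower) simp
    also have "\<dots> \<le> liminf (\<lambda>k. \<integral>\<^sup>+\<mu>. X ?N k \<mu> \<partial>\<nu>)"
      unfolding Q_def by (rule nn_integral_liminf) measurable
    also have "\<dots> \<le> liminf (\<lambda>k :: nat. ennreal \<epsilon>)"
      by (intro Liminf_mono always_eventually allI X)
    also have "\<dots> = ennreal \<epsilon>" by (simp add: Liminf_const)
    finally show ?thesis by simp
  qed
  then have "(\<integral>\<^sup>+\<mu>. R \<mu> \<partial>\<nu>) \<le> 0" by (rule ennreal_le_epsilon)
  then have "AE \<mu> in \<nu>. R \<mu> = 0" by (simp add: nn_integral_0_iff_AE)
  then show ?thesis
  proof eventually_elim
    case (elim \<mu>)
    show ?case
    proof (intro allI impI)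
      fix \<epsilon> :: real assume "0 < \<epsilon>"
      then have "R \<mu> < ennreal \<epsilon>" using elim by simp
      then obtain N :: nat where "Q N \<mu> < ennreal \<epsilon>" unfolding R_def INF_less_iff by blast
      then show "\<exists>N :: nat. liminf (\<lambda>k. \<integral>\<^sup>+t. log_excess N (norm (det (F (of_real (\<rho> k) * t) - mat \<mu>))) \<partial>circle_measure) < ennreal \<epsilon>"
        by (auto simp: Q_def X_def d_def)
    qed
  qed
qed

section \<open>Boundary behaviour of the inner determinant and the conclusion\<close>

lemma norm_det_unitary:
  assumes "unitary_matrix U"
  shows "norm (det U) = 1"
proof -
  have "det (conj_transpose U ** U) = 1"
    using assms by (simp add: unitary_matrix_def)
  then have "norm (cnj (det U) * det U) = 1"
    by (simp add: det_mul det_conj_transpose)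
  then have "(norm (det U))\<^sup>2 = 1\<^sup>2"
    by (simp add: norm_mult power2_eq_square)
  then show ?thesis by (rule power2_eq_imp_eq) auto
qed

lemma AE_det_radial_limit:
  assumes "\<Theta> \<in> inner_class"
  shows "AE t in circle_measure. ((\<lambda>r. norm (det (\<Theta> (of_real r * t)))) \<longlongrightarrow> 1) (at_left 1)"
proof -
  have "AE t in circle_measure. \<exists>U. has_radial_limit \<Theta> t U \<and> unitary_matrix U"
    using assms by (simp add: inner_class_def)
  then show ?thesis
  proof eventually_elim
    case (elim t)
    then obtain U where U: "has_radial_limit \<Theta> t U" "unitary_matrix U" by blast
    have "((\<lambda>r. norm (det (\<Theta> (of_real r * t)))) \<longlongrightarrow> norm (det U)) (at_left 1)"
      using U(1) unfolding has_radial_limit_def by (intro tendsto_norm tendsto_det)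
    then show ?case by (simp add: norm_det_unitary[OF U(2)])
  qed
qed

theorem theorem6p2:
  fixes F :: "complex \<Rightarrow> complex^'n^'n"
    and E \<Theta> :: "complex \<Rightarrow> complex \<Rightarrow> complex^'n^'n"
    and K :: "complex set"
  assumes "F \<in> smirnov_class"
    and "\<And>\<mu>. \<mu> \<in> UNIV - degenerate_set F \<Longrightarrow> \<Theta> \<mu> \<in> inner_class"
    and "\<And>\<mu>. \<mu> \<in> UNIV - degenerate_set F \<Longrightarrow> E \<mu> \<in> outer_class"
    and "\<And>\<mu> z. \<mu> \<in> UNIV - degenerate_set F \<Longrightarrow> z \<in> ball 0 1 \<Longrightarrow>
           matrix_shift F \<mu> z = E \<mu> z ** \<Theta> \<mu> z"
    and "bounded K"
    and "K \<in> sets borel"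
    and "positive_log_capacity K"
  shows "\<exists>\<mu> \<in> K \<inter> (UNIV - degenerate_set F). blaschke_potapov_product (\<Theta> \<mu>)"
proof -
  from \<open>positive_log_capacity K\<close> obtain \<nu> S where \<nu>: "finite_measure \<nu>" "sets \<nu> = sets borel"
      "compact S" "emeasure \<nu> (UNIV - S) = 0" "\<And>\<xi>. finite_log_potential \<nu> \<xi>"
      "continuous_on UNIV (log_potential \<nu>)"
    and nonzero: "emeasure \<nu> UNIV \<noteq> 0" and K0: "emeasure \<nu> (UNIV - K) = 0"
    unfolding positive_log_capacity_def by blast
  have space: "space \<nu> = UNIV" using sets_eq_imp_space_eq[OF \<nu>(2)] by simp
  have F: "matrix_holomorphic F" using assms(1) by (simp add: smirnov_class_def)
  \<comment> \<open>Any sequence in the open unit interval tending to 1 would serve; the shift by 2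
    keeps the first term positive.\<close>
  define \<rho> where "\<rho> k = 1 - 1 / real (k + 2)" for k :: nat
  have \<rho>: "0 < \<rho> k" "\<rho> k < 1" for k by (simp_all add: \<rho>_def field_simps)
  have "(\<lambda>k. 1 / real (k + 2)) \<longlonglongrightarrow> 0"
    using LIMSEQ_ignore_initial_segment[OF lim_1_over_n, of 2] by simp
  then have \<rho>_lim: "\<rho> \<longlonglongrightarrow> 1"
    unfolding \<rho>_def using tendsto_diff[OF tendsto_const[of 1]] by fastforce
  have "AE \<mu> in \<nu>. \<mu> \<in> K"
    using K0 assms(6) by (intro AE_I[of _ _ "UNIV - K"]) (auto simp: \<nu>(2) space)
  \<comment> \<open>A degenerate \<mu> is in particular an eigenvalue of \<open>F 0\<close>, so
    there are finitely many, and \<open>\<nu>\<close> has no atoms.\<close>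
  moreover have "AE \<mu> in \<nu>. \<mu> \<notin> degenerate_set F"
  proof -
    have "finite {\<mu>. det (F 0 - mat \<mu>) = 0}" by (rule finite_det_shift_zeros)
    then have "AE \<mu> in \<nu>. \<forall>\<xi> \<in> {\<mu>. det (F 0 - mat \<mu>) = 0}. \<mu> \<noteq> \<xi>"
      by (rule AE_finite_allI) (rule finite_log_potential_AE[OF \<nu>(2,5)])
    then show ?thesis
      by eventually_elim (auto simp: degenerate_set_def matrix_shift_def)
  qed
  moreover note AE_det_shift_log_excess_small[where \<rho> = \<rho>, OF F \<nu> \<rho>]
  ultimately have ae: "AE \<mu> in \<nu>. \<mu> \<in> K \<and> \<mu> \<notin> degenerate_set F \<and> (\<forall>\<epsilon>>0. \<exists>N :: nat.
    liminf (\<lambda>k. \<integral>\<^sup>+t. log_excess N (norm (det (F (of_real (\<rho> k) * t) - mat \<mu>))) \<partial>circle_measure) < ennreal \<epsilon>)"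
    by eventually_elim blast
  \<comment> \<open>Since \<open>\<nu>\<close> is not the zero measure, a property that holds almost
    everywhere has a witness.\<close>
  have "ae_filter \<nu> \<noteq> bot"
    using nonzero by (simp add: ae_filter_eq_bot_iff space)
  from eventually_happens'[OF this ae] obtain \<mu> where \<mu>: "\<mu> \<in> K" "\<mu> \<notin> degenerate_set F"
    and excess: "\<And>\<epsilon>. 0 < \<epsilon> \<Longrightarrow> \<exists>N :: nat.
    liminf (\<lambda>k. \<integral>\<^sup>+t. log_excess N (norm (det (F (of_real (\<rho> k) * t) - mat \<mu>))) \<partial>circle_measure) < ennreal \<epsilon>"
    by blast
  have \<mu>': "\<mu> \<in> UNIV - degenerate_set F" using \<mu>(2) by simp
  define \<theta> where "\<theta> z = det (\<Theta> \<mu> z)" for z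
  have inner: "\<Theta> \<mu> \<in> inner_class" and outer: "outer_function (\<lambda>z. det (E \<mu> z))"
    using assms(2,3)[OF \<mu>'] by (simp_all add: outer_class_def)
  have \<Theta>: "holomorphic_contraction (\<Theta> \<mu>)"
    using inner by (simp add: inner_class_def holomorphic_contraction_def contraction_iff_opnorm)
  have fac: "det (F z - mat \<mu>) = det (E \<mu> z) * \<theta> z" if "norm z < 1" for z
    using assms(4)[OF \<mu>', of z] that by (simp add: matrix_shift_def det_mul \<theta>_def)
  obtain z0 where z0: "norm z0 < 1" "\<theta> z0 \<noteq> 0"
    using \<mu>(2) fac by (auto simp: degenerate_set_def matrix_shift_def)
  have \<theta>_hol: "\<theta> holomorphic_on ball 0 1"
    unfolding \<theta>_def using \<Theta> by (intro matrix_holomorphic_det) (simp add: holomorphic_contraction_def)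
  have d_hol: "(\<lambda>z. det (F z - mat \<mu>)) holomorphic_on ball 0 1"
  proof (rule holomorphic_on_det)
    show "(\<lambda>z. (F z - mat \<mu>) $ i $ j) holomorphic_on ball 0 1" for i j
      using F by (auto simp: matrix_holomorphic_def intro!: holomorphic_intros)
  qed
  have mean: "\<exists>r. 0 < r \<and> r < 1 \<and>
      (\<integral>\<^sup>+t. log_excess 0 (norm (\<theta> (of_real r * t))) \<partial>circle_measure) < ennreal \<epsilon>" if "0 < \<epsilon>" for \<epsilon>
  proof (rule inner_factor_log_mean_small[OF outer _ _ _ fac _ \<rho> \<rho>_lim excess that])
    show "continuous_on (ball 0 1) \<theta>" "continuous_on (ball 0 1) (\<lambda>z. det (F z - mat \<mu>))"
      by (intro holomorphic_on_imp_continuous_on \<theta>_hol d_hol)+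
    show "norm (\<theta> z) \<le> 1" if "norm z < 1" for z
      unfolding \<theta>_def using \<Theta> that by (intro norm_det_contraction_le_1) (simp add: holomorphic_contraction_def)
    show "AE t in circle_measure. ((\<lambda>r. norm (\<theta> (of_real r * t))) \<longlongrightarrow> 1) (at_left 1)"
      unfolding \<theta>_def by (rule AE_det_radial_limit[OF inner])
  qed
  have "left_blaschke_potapov (\<Theta> \<mu>)"
  proof (rule left_blaschke_potapovI[OF \<Theta> z0[unfolded \<theta>_def]])
    fix \<epsilon> :: real assume "0 < \<epsilon>"
    from mean[OF this] obtain r where r: "0 < r" "r < 1"
      and m: "(\<integral>\<^sup>+t. log_excess 0 (norm (\<theta> (of_real r * t))) \<partial>circle_measure) < ennreal \<epsilon>" by blast
    show "\<exists>R. 0 < R \<and> R < 1 \<and> (\<forall>g. g holomorphic_on ball 0 1 \<longrightarrow>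
      (\<forall>z. norm z < 1 \<longrightarrow> norm (det (\<Theta> \<mu> z)) \<le> norm (g z) \<and> norm (g z) \<le> 1) \<longrightarrow>
      (\<forall>z. norm z < R \<longrightarrow> g z \<noteq> 0) \<longrightarrow> 1 - \<epsilon> \<le> norm (g 0))"
    \<comment> \<open>A radius strictly between \<open>r\<close> and 1, so that the circle of radius
      \<open>r\<close> carrying the small mean lies inside the zero-free disc of
      \<open>g\<close>.\<close>
    proof (intro exI[of _ "(1 + r) / 2"] conjI allI impI)
      fix g assume g: "g holomorphic_on ball 0 1"
        "\<forall>z. norm z < 1 \<longrightarrow> norm (det (\<Theta> \<mu> z)) \<le> norm (g z) \<and> norm (g z) \<le> 1"
        "\<forall>z. norm z < (1 + r) / 2 \<longrightarrow> g z \<noteq> 0"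
      show "1 - \<epsilon> \<le> norm (g 0)"
        by (rule norm_at_0_ge_of_log_mean[OF g(1) _ _ r(1) _ _ _ m, of "(1 + r) / 2"])
          (use r g in \<open>auto simp: \<theta>_def\<close>)
    qed (use r in auto)
  qed
  then show ?thesis
    using \<mu> unfolding blaschke_potapov_product_def by blast
qed

end
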